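(* Let $SU(2)$ be endowed with the left invariant metric $$g=\epsilon A_0\,\theta^1\otimes\theta^1+B_0\,\theta^2\otimes\theta^2+C_0\,\theta^3\otimes\theta^3,$$ with $\epsilon,A_0,B_0,C_0>0$, and let $(g_t)_{t\in[0,T_{\max})}$ be the evolution of $g$ under the Ricci flow. Let $\Omega\subset SU(2)$ be a precompact domain with smooth nonempty boundary. Suppose that $$\epsilon A_0\le C_0\le B_0,\qquad \delta:=\frac{B_0-\epsilon A_0}{\epsilon A_0}<1.$$ Then for every $t$ with $0\le t<\min\left\{\frac{B_0}{4(1+6\delta)},T_{\max}\right\}$, $$\left[1-\frac{4(1+6\delta)t}{B_0}\right]^{\frac{5(1+\delta)^3}{2(1+6\delta)}}\mathcal{T}(\Omega_0)\le \mathcal{T}(\Omega_t)\le \left[1-\frac{4t}{B_0}\right]^{\frac{5(1-\delta)}{2(1+\delta)}}\mathcal{T}(\Omega_0).$$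
   Context: $\{F_1,F_2,F_3\}$ is a Milnor frame of left invariant vector fields on $SU(2)$, normalized so that (up to an overall sign) $[F_i,F_j]=2F_k$ for cyclic permutations $(i,j,k)$ of $(1,2,3)$, and $\{\theta^i\}$ are the dual one-forms. With this normalization, the metric $D\theta^1\otimes\theta^1+B\theta^2\otimes\theta^2+C\theta^3\otimes\theta^3$ has Ricci curvatures $\frac{2}{BCD}[D^2-(B-C)^2]$, $\frac{2}{BCD}[B^2-(D-C)^2]$, $\frac{2}{BCD}[C^2-(D-B)^2]$ in the unit directions of $F_1,F_2,F_3$ respectively. The Ricci flow is $\frac{\partial}{\partial t}g_t=-2\,\mathrm{Ric}_{g_t}$, $g_0=g$, with maximal existence time $T_{\max}$; it stays of the diagonal form $g_t=D(t)\theta^1\otimes\theta^1+B(t)\theta^2\otimes\theta^2+C(t)\theta^3\otimes\theta^3$. The torsional rigidity is $\mathcal{T}(\Omega_t)=\int_\Omega E_t\,d\mathrm{V}_t$, where $d\mathrm{V}_t$ is the volume element of $g_t$ and $E_t$ solves $\Delta_{g_t}E_t=-1$ in $\Omega$, $E_t=0$ on $\partial\Omega$. *)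

theory Defs
  imports "HOL-Analysis.Analysis"
begin

section \<open>The group and its Milnor frame\<close>

type_synonym mat2 = "complex^2^2"

text \<open>
  \<open>SU(2)\<close> is a subset of the space of complex 2 by 2 matrices, with the subspace topology.
  Functions and tensor fields on it are total functions on matrices; only their
  values on \<open>SU2\<close> are ever used.
\<close>

definition SU2 :: "mat2 set" where
  "SU2 = {A. A ** (\<chi> i j. cnj (A $ j $ i)) = mat 1 \<and> det A = 1}"

definition su2_basis :: "3 \<Rightarrow> mat2" where
  "su2_basis i =
     (if i = 1 then vector [vector [\<i>, 0], vector [0, - \<i>]]
      else if i = 2 then vector [vector [0, 1], vector [- 1, 0]]
      else vector [vector [0, \<i>], vector [\<i>, 0]])"

text \<open>
  Structure constants of the frame: \<open>[F\<^sub>i, F\<^sub>j] = (\<Sum>k. struct_const i j k * F\<^sub>k)\<close>,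
  i.e. \<open>[F\<^sub>i, F\<^sub>j] = 2 F\<^sub>k\<close> for cyclic \<open>(i, j, k)\<close>. The bracket of left invariant
  fields on a matrix group is the commutator, see \<open>su2_basis_commutator\<close> below.
\<close>

definition struct_const :: "3 \<Rightarrow> 3 \<Rightarrow> 3 \<Rightarrow> real" where
  "struct_const i j k =
     (if (i, j, k) \<in> {(1, 2, 3), (2, 3, 1), (3, 1, 2)} then 2
      else if (i, j, k) \<in> {(2, 1, 3), (3, 2, 1), (1, 3, 2)} then - 2
      else 0)"

lemma su2_basis_commutator:
  "su2_basis i ** su2_basis j - su2_basis j ** su2_basis i
     = (\<Sum>k\<in>UNIV. struct_const i j k *\<^sub>R su2_basis k)"
  using exhaust_3[of i] exhaust_3[of j]
  by (auto simp: su2_basis_def struct_const_def sum_3 sum_2 vec_eq_iff forall_2 forall_3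
      matrix_matrix_mult_def vector_2 complex_eq_iff)

text \<open>
  Since \<open>su2_basis i\<close> squares to \<open>- 1\<close>, this is the matrix exponential of \<open>s\<close> times
  \<open>su2_basis i\<close>; \<open>s \<mapsto> p ** one_param i s\<close> is the integral curve through \<open>p\<close> of the left
  invariant field \<open>F\<^sub>i\<close>.
\<close>

definition one_param :: "3 \<Rightarrow> real \<Rightarrow> mat2" where
  "one_param i s = cos s *\<^sub>R mat 1 + sin s *\<^sub>R su2_basis i"

lemma su2_basis_square: "su2_basis i ** su2_basis i = - mat 1"
  using exhaust_3[of i]
  by (auto simp: su2_basis_def sum_2 vec_eq_iff forall_2 matrix_matrix_mult_def vector_2 mat_def)

definition frame_deriv :: "3 \<Rightarrow> (mat2 \<Rightarrow> real) \<Rightarrow> mat2 \<Rightarrow> real" where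
  "frame_deriv i f p = deriv (\<lambda>s. f (p ** one_param i s)) 0"

text \<open>
  \<open>C\<^sup>k\<close> regularity on a relatively open subset of \<open>SU2\<close>. As \<open>F\<^sub>1, F\<^sub>2, F\<^sub>3\<close> is a global
  frame of the tangent bundle, existence and continuity of the iterated frame derivatives
  is the usual notion.
\<close>

primrec Ck_on :: "nat \<Rightarrow> mat2 set \<Rightarrow> (mat2 \<Rightarrow> real) \<Rightarrow> bool" where
  "Ck_on 0 U f \<longleftrightarrow> continuous_on U f"
| "Ck_on (Suc k) U f \<longleftrightarrow> continuous_on U f \<and>
     (\<forall>i. (\<forall>p\<in>U. (\<lambda>s. f (p ** one_param i s)) differentiable at 0) \<and>
          Ck_on k U (frame_deriv i f))"

definition smooth_on :: "mat2 set \<Rightarrow> (mat2 \<Rightarrow> real) \<Rightarrow> bool" where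
  "smooth_on U f \<longleftrightarrow> (\<forall>k. Ck_on k U f)"


section \<open>Riemannian metrics on \<open>SU(2)\<close>\<close>

text \<open>
  A metric is given by its Gram matrices in the global frame: \<open>g p $ i $ j\<close> is
  \<open>g(F\<^sub>i, F\<^sub>j)\<close> at \<open>p\<close>, that is, \<open>g = (\<Sum>i j. g\<^sub>i\<^sub>j \<theta>\<^sup>i \<otimes> \<theta>\<^sup>j)\<close>. Every Riemannian
  metric on \<open>SU(2)\<close> is of this form; the left invariant ones are those with constant
  Gram matrix.
\<close>

type_synonym su2_tensor = "mat2 \<Rightarrow> real^3^3"

definition riemannian_metric :: "su2_tensor \<Rightarrow> bool" where
  "riemannian_metric g \<longleftrightarrow>
     (\<forall>i j. smooth_on SU2 (\<lambda>p. g p $ i $ j)) \<and>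
     (\<forall>p\<in>SU2. transpose (g p) = g p \<and> (\<forall>v. v \<noteq> 0 \<longrightarrow> v \<bullet> (g p *v v) > 0))"

definition diag3 :: "real \<Rightarrow> real \<Rightarrow> real \<Rightarrow> real^3^3" where
  "diag3 a b c =
     (\<chi> i j. if i \<noteq> j then 0 else if i = 1 then a else if i = 2 then b else c)"

text \<open>
  Koszul's formula for \<open>g(\<nabla>\<^sub>F\<^sub>i F\<^sub>j, F\<^sub>k)\<close>, and the resulting components
  \<open>\<nabla>\<^sub>F\<^sub>i F\<^sub>j = (\<Sum>l. christoffel g i j l * F\<^sub>l)\<close> of the Levi-Civita connection.
\<close>

definition koszul :: "su2_tensor \<Rightarrow> 3 \<Rightarrow> 3 \<Rightarrow> 3 \<Rightarrow> mat2 \<Rightarrow> real" where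
  "koszul g i j k p =
     (frame_deriv i (\<lambda>q. g q $ j $ k) p + frame_deriv j (\<lambda>q. g q $ i $ k) p
        - frame_deriv k (\<lambda>q. g q $ i $ j) p
      + (\<Sum>m\<in>UNIV. struct_const i j m * g p $ m $ k)
      - (\<Sum>m\<in>UNIV. struct_const i k m * g p $ m $ j)
      - (\<Sum>m\<in>UNIV. struct_const j k m * g p $ m $ i)) / 2"

definition christoffel :: "su2_tensor \<Rightarrow> 3 \<Rightarrow> 3 \<Rightarrow> 3 \<Rightarrow> mat2 \<Rightarrow> real" where
  "christoffel g i j l p = (\<Sum>k\<in>UNIV. matrix_inv (g p) $ l $ k * koszul g i j k p)"

text \<open>
  Component along \<open>F\<^sub>l\<close> of
  \<open>R(F\<^sub>i, F\<^sub>j) F\<^sub>k = \<nabla>\<^sub>F\<^sub>i \<nabla>\<^sub>F\<^sub>j F\<^sub>k - \<nabla>\<^sub>F\<^sub>j \<nabla>\<^sub>F\<^sub>i F\<^sub>k - \<nabla>\<^bsub>[F\<^sub>i, F\<^sub>j]\<^esub> F\<^sub>k\<close>.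
\<close>

definition riemann :: "su2_tensor \<Rightarrow> 3 \<Rightarrow> 3 \<Rightarrow> 3 \<Rightarrow> 3 \<Rightarrow> mat2 \<Rightarrow> real" where
  "riemann g i j k l p =
     frame_deriv i (christoffel g j k l) p - frame_deriv j (christoffel g i k l) p
     + (\<Sum>m\<in>UNIV. christoffel g j k m p * christoffel g i m l p)
     - (\<Sum>m\<in>UNIV. christoffel g i k m p * christoffel g j m l p)
     - (\<Sum>m\<in>UNIV. struct_const i j m * christoffel g m k l p)"

definition ricci :: "su2_tensor \<Rightarrow> su2_tensor" where
  "ricci g p = (\<chi> j k. \<Sum>i\<in>UNIV. riemann g i j k i p)"

text \<open>The Laplace-Beltrami operator, as the \<open>g\<close>-trace of the Hessian.\<close>

definition laplacian :: "su2_tensor \<Rightarrow> (mat2 \<Rightarrow> real) \<Rightarrow> mat2 \<Rightarrow> real" where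
  "laplacian g f p =
     (\<Sum>i\<in>UNIV. \<Sum>j\<in>UNIV. matrix_inv (g p) $ i $ j *
        (frame_deriv i (frame_deriv j f) p
         - (\<Sum>k\<in>UNIV. christoffel g i j k p * frame_deriv k f p)))"

text \<open>
  The volume form \<open>\<theta>\<^sup>1 \<and> \<theta>\<^sup>2 \<and> \<theta>\<^sup>3\<close> as a measure. The frame is orthonormal for the metric
  that \<open>SU(2)\<close> carries as the unit sphere of \<open>\<complex>\<^sup>2\<close>, so this is the surface measure of the
  unit 3-sphere, i.e. 4 times the Lebesgue measure of the radial cone in the unit ball
  (total mass \<open>2 \<pi>\<^sup>2\<close>).
\<close>

definition sphere_to_SU2 :: "complex^2 \<Rightarrow> mat2" where
  "sphere_to_SU2 z = vector [vector [z $ 1, - cnj (z $ 2)], vector [z $ 2, cnj (z $ 1)]]"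

definition frame_volume :: "mat2 measure" where
  "frame_volume =
     distr (density lborel (\<lambda>z. 4 * indicator (ball 0 1) z)) borel
       (\<lambda>z. sphere_to_SU2 (z /\<^sub>R norm z))"

definition riemannian_volume :: "su2_tensor \<Rightarrow> mat2 measure" where
  "riemannian_volume g = density frame_volume (\<lambda>p. ennreal (sqrt (det (g p))))"


section \<open>Ricci flow\<close>

text \<open>
  A smooth solution on \<open>[0, T)\<close>. The regularity clause asks that all iterated
  spatial derivatives are jointly continuous in time and space; time derivatives are
  controlled by the evolution equation itself. At \<open>t = 0\<close> the time derivative is one-sided.
\<close>

definition ricci_flow :: "(real \<Rightarrow> su2_tensor) \<Rightarrow> ereal \<Rightarrow> bool" where
  "ricci_flow g T \<longleftrightarrow> 0 < T \<and>
     (\<forall>t. 0 \<le> t \<and> ereal t < T \<longrightarrow> riemannian_metric (g t)) \<and>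
     (\<forall>I i j. continuous_on ({t. 0 \<le> t \<and> ereal t < T} \<times> SU2)
        (\<lambda>(t, p). fold frame_deriv I (\<lambda>q. g t q $ i $ j) p)) \<and>
     (\<forall>t p. 0 \<le> t \<and> ereal t < T \<and> p \<in> SU2 \<longrightarrow>
        ((\<lambda>s. g s p) has_vector_derivative - 2 *\<^sub>R ricci (g t) p) (at t within {0..}))"

definition maximal_ricci_flow :: "(real \<Rightarrow> su2_tensor) \<Rightarrow> ereal \<Rightarrow> bool" where
  "maximal_ricci_flow g T \<longleftrightarrow> ricci_flow g T \<and>
     \<not> (\<exists>h T'. T < T' \<and> ricci_flow h T' \<and>
          (\<forall>t p. 0 \<le> t \<and> ereal t < T \<and> p \<in> SU2 \<longrightarrow> h t p = g t p))"


section \<open>Domains and torsional rigidity\<close>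

abbreviation SU2_boundary :: "mat2 set \<Rightarrow> mat2 set" where
  "SU2_boundary \<Omega> \<equiv> (top_of_set SU2) frontier_of \<Omega>"

definition smooth_boundary :: "mat2 set \<Rightarrow> bool" where
  "smooth_boundary \<Omega> \<longleftrightarrow>
     (\<forall>p\<in>SU2_boundary \<Omega>. \<exists>U f. openin (top_of_set SU2) U \<and> p \<in> U \<and> smooth_on U f \<and>
        (\<exists>i. frame_deriv i f p \<noteq> 0) \<and> \<Omega> \<inter> U = {q \<in> U. f q < 0})"

definition precompact_smooth_domain :: "mat2 set \<Rightarrow> bool" where
  "precompact_smooth_domain \<Omega> \<longleftrightarrow>
     openin (top_of_set SU2) \<Omega> \<and> \<Omega> \<noteq> {} \<and> connected \<Omega> \<and> compact (closure \<Omega>) \<and>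
     SU2_boundary \<Omega> \<noteq> {} \<and> smooth_boundary \<Omega>"

text \<open>
  Classical solutions of \<open>\<Delta> E = -1\<close> in \<open>\<Omega>\<close>, \<open>E = 0\<close> on the boundary. They are unique by
  the maximum principle, so \<open>torsional_rigidity g \<Omega> E\<close> below depends on \<open>g\<close> and \<open>\<Omega>\<close> only.
\<close>

definition torsion_function :: "su2_tensor \<Rightarrow> mat2 set \<Rightarrow> (mat2 \<Rightarrow> real) \<Rightarrow> bool" where
  "torsion_function g \<Omega> E \<longleftrightarrow>
     continuous_on (closure \<Omega>) E \<and> Ck_on 2 \<Omega> E \<and>
     (\<forall>p\<in>\<Omega>. laplacian g E p = - 1) \<and> (\<forall>p\<in>SU2_boundary \<Omega>. E p = 0)"

definition torsional_rigidity :: "su2_tensor \<Rightarrow> mat2 set \<Rightarrow> (mat2 \<Rightarrow> real) \<Rightarrow> real" where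
  "torsional_rigidity g \<Omega> E = (LINT p:\<Omega>|riemannian_volume g. E p)"

end

theory Submission
  imports Defs
begin

text \<open>
  For a left invariant diagonal metric the Laplacian is \<open>\<Sum>i. F\<^sub>i F\<^sub>i / g\<^sub>i\<close>, because the frame is
  unimodular, and the volume is a constant multiple of the bi-invariant one. If \<open>g\<close> and \<open>g'\<close> are two
  such metrics with \<open>g'\<^sub>i \<le> r * g\<^sub>i\<close>, testing the two torsion equations against each other gives, with
  integrals in the invariant measure,
  \<open>2 \<integral>E' = 2 \<integral>g(\<nabla>E', \<nabla>E) \<le> (1 / r) \<integral>|\<nabla>E'|\<^sup>2 + r \<integral>|\<nabla>E|\<^sup>2\<close> with gradients and norms of \<open>g\<close>.
  The first term is at most the energy of \<open>E'\<close> for \<open>g'\<close>, that is \<open>\<integral>E'\<close>, and the second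
  one is \<open>r \<integral>E\<close>. Hence \<open>\<integral>E' \<le> r \<integral>E\<close>; the volume
  factor contributes another \<open>r powr (3 / 2)\<close>. Integration by parts is carried out with
  functions \<open>\<phi>(E)\<close>, where \<open>\<phi>\<close> vanishes near 0: they have compact support in the domain, so that
  only the right invariance of the measure is used, and neither boundary regularity nor
  integrability of the gradients.

  Along the flow \<open>D \<le> C \<le> B \<le> (1 + \<delta>) D\<close> persists. This gives
  \<open>B\<^sub>0 - 4 (1 + 6 \<delta>) t \<le> B \<le> B\<^sub>0 - 4 t\<close>, then two-sided bounds for the Ricci curvatures, and so
  bounds for the ratios of the metric coefficients at times \<open>t\<close> and \<open>0\<close>.
\<close>

section \<open>Invariance of the volume under right translations\<close>

text \<open>Lebesgue measure is determined by its values on boxes, and the preimage of a box is its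
  image under the inverse map, which is again orthogonal and so preserves measure.\<close>

lemma distr_lborel_orthogonal:
  fixes f :: "real^'n::{finite,wellorder} \<Rightarrow> real^'n::{finite,wellorder}"
  assumes f: "orthogonal_transformation f"
  shows "distr lborel borel f = lborel"
proof (rule lborel_eqI[symmetric])
  have lin: "linear f" using f orthogonal_transformation_linear by blast
  have meas: "f \<in> borel_measurable lborel"
    using lin by (simp add: linear_continuous_on linear_conv_bounded_linear borel_measurable_continuous_onI)
  fix l u :: "real^'n::{finite,wellorder}" assume lu: "\<And>b. b \<in> Basis \<Longrightarrow> l \<bullet> b \<le> u \<bullet> b"
  have bij: "bij f" using f orthogonal_transformation_bij by blast
  have inv: "orthogonal_transformation (inv f)" using f orthogonal_transformation_inv by blast
  have vim: "f -` box l u = inv f ` box l u" using bij by (simp add: bij_vimage_eq_inv_image)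
  have "emeasure (distr lborel borel f) (box l u) = emeasure lborel (f -` box l u)"
    using meas by (simp add: emeasure_distr)
  also have "\<dots> = emeasure lebesgue (inv f ` box l u)"
    unfolding vim[symmetric] using measurable_sets[OF meas, of "box l u"] by simp
  also have "\<dots> = emeasure lebesgue (box l u)"
    using measure_orthogonal_image[OF inv, of "box l u"] measurable_orthogonal_image[OF inv, of "box l u"]
    by (metis emeasure_eq_measure2 lmeasurable_box)
  also have "\<dots> = ennreal (\<Prod>b\<in>Basis. (u - l) \<bullet> b)"
    using lu by (simp add: emeasure_lborel_box)
  finally show "emeasure (distr lborel borel f) (box l u) = ennreal (\<Prod>b\<in>Basis. (u - l) \<bullet> b)" .
qed simp

text \<open>
  The library has invariance of Lebesgue measure under orthogonal maps for \<open>real^'n\<close> only, so it is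
  transported to \<open>complex^2\<close>.
\<close>

definition cplx2 :: "real^4 \<Rightarrow> complex^2" where
  "cplx2 x = vector [Complex (x$1) (x$2), Complex (x$3) (x$4)]"

definition real4 :: "complex^2 \<Rightarrow> real^4" where
  "real4 z = vector [Re (z$1), Im (z$1), Re (z$2), Im (z$2)]"

lemma vector_4:
  "(vector [a, b, c, d] :: 'a::zero^4) $ 1 = a" "(vector [a, b, c, d] :: 'a::zero^4) $ 2 = b"
  "(vector [a, b, c, d] :: 'a::zero^4) $ 3 = c" "(vector [a, b, c, d] :: 'a::zero^4) $ 4 = d"
  by (simp_all add: vector_def)

lemma cplx2_real4 [simp]: "cplx2 (real4 z) = z" "real4 (cplx2 x) = x"
  by (simp_all add: cplx2_def real4_def vec_eq_iff forall_2 forall_4 vector_4)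

lemma linear_cplx2: "linear cplx2"
  by (rule linearI) (simp_all add: cplx2_def vec_eq_iff forall_2 complex_eq_iff)

lemma linear_real4: "linear real4"
  by (rule linearI) (simp_all add: real4_def vec_eq_iff forall_4 vector_4)

lemma norm_real4: "norm (real4 z) = norm z"
  by (simp add: norm_vec_def L2_set_def sum_2 sum_4 real4_def vector_4 cmod_power2)

lemma Basis_complex2: "(Basis :: (complex^2) set) = {axis 1 1, axis 1 \<i>, axis 2 1, axis 2 \<i>}"
  by (auto simp: Basis_vec_def UNIV_2 Basis_complex_def)

lemma Basis_real4: "(Basis :: (real^4) set) = {axis 1 1, axis 2 1, axis 3 1, axis 4 1}"
  by (auto simp: Basis_vec_def UNIV_4)

text \<open>\<open>cplx2\<close> only regroups real coordinates, so the preimage of a box is a box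
  with the same side lengths.\<close>

lemma distr_lborel_cplx2: "distr lborel borel cplx2 = lborel"
proof (rule lborel_eqI[symmetric])
  fix l u :: "complex^2" assume lu: "\<And>b. b \<in> Basis \<Longrightarrow> l \<bullet> b \<le> u \<bullet> b"
  have meas: "cplx2 \<in> borel_measurable lborel"
    using linear_cplx2 by (simp add: linear_continuous_on linear_conv_bounded_linear borel_measurable_continuous_onI)
  have eq: "cplx2 -` box l u = box (real4 l) (real4 u)"
    by (auto simp: mem_box Basis_complex2 Basis_real4 inner_axis cplx2_def real4_def vector_4)
  have le: "\<And>b. b \<in> Basis \<Longrightarrow> real4 l \<bullet> b \<le> real4 u \<bullet> b"
    using lu[of "axis 1 1"] lu[of "axis 1 \<i>"] lu[of "axis 2 1"] lu[of "axis 2 \<i>"]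
    by (auto simp: Basis_complex2 Basis_real4 inner_axis real4_def vector_4)
  have "(\<Prod>b\<in>Basis. (real4 u - real4 l) \<bullet> b) = (\<Prod>b\<in>Basis. (u - l) \<bullet> b)"
    unfolding Basis_complex2 Basis_real4
    by (simp add: axis_eq_axis inner_axis real4_def vector_4)
  then show "emeasure (distr lborel borel cplx2) (box l u) = ennreal (\<Prod>b\<in>Basis. (u - l) \<bullet> b)"
    using meas le by (simp add: emeasure_distr eq emeasure_lborel_box)
qed simp

text \<open>Conjugation with \<open>cplx2\<close> turns \<open>f\<close> into an orthogonal map of
  \<open>real^4\<close>. Linearity is over the reals, so maps that involve complex conjugation are
  covered.\<close>

lemma distr_lborel_isometry_complex2:
  fixes f :: "complex^2 \<Rightarrow> complex^2"
  assumes lin: "linear f" and norm: "\<And>z. norm (f z) = norm z"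
  shows "distr lborel borel f = lborel"
proof -
  define h where "h = real4 \<circ> f \<circ> cplx2"
  have "linear h" unfolding h_def using lin linear_cplx2 linear_real4 by (intro linear_compose)
  moreover have "norm (h x) = norm x" for x
    unfolding h_def by (metis comp_apply cplx2_real4(2) norm norm_real4)
  ultimately have h: "orthogonal_transformation h" by (simp add: orthogonal_transformation)
  have meas: "f \<in> borel_measurable borel" "cplx2 \<in> borel_measurable borel" "h \<in> borel_measurable borel"
    using lin linear_cplx2 \<open>linear h\<close>
    by (simp_all add: linear_continuous_on linear_conv_bounded_linear borel_measurable_continuous_onI)
  have "distr lborel borel f = distr (distr lborel borel cplx2) borel f"
    by (simp add: distr_lborel_cplx2)
  also have "\<dots> = distr lborel borel (f \<circ> cplx2)"
    using meas by (intro distr_distr) auto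
  also have "f \<circ> cplx2 = cplx2 \<circ> h" by (auto simp: h_def)
  also have "distr lborel borel (cplx2 \<circ> h) = distr (distr lborel borel h) borel cplx2"
    using meas by (intro distr_distr[symmetric]) auto
  also have "\<dots> = lborel"
    using distr_lborel_orthogonal[OF h] by (simp add: distr_lborel_cplx2)
  finally show ?thesis .
qed

section \<open>\<open>SU2\<close> as the group of unit quaternions\<close>

lemma one_param_0 [simp]: "one_param i 0 = mat 1"
  by (simp add: one_param_def)

lemma mat2_scaleR_left: "(a *\<^sub>R A) ** B = a *\<^sub>R (A ** (B::mat2))"
  by (simp add: vec_eq_iff matrix_matrix_mult_def sum_2 scaleR_add_right)

lemma mat2_scaleR_right: "A ** (a *\<^sub>R B) = a *\<^sub>R (A ** (B::mat2))"
  by (simp add: vec_eq_iff matrix_matrix_mult_def sum_2 scaleR_add_right)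

lemma mat2_add_rdistrib: "(A + B) ** C = A ** C + B ** (C::mat2)"
  by (simp add: vec_eq_iff matrix_matrix_mult_def sum_2 algebra_simps)

lemma one_param_add: "one_param i s ** one_param i r = one_param i (s + r)"
  unfolding one_param_def
  by (simp add: matrix_add_ldistrib mat2_add_rdistrib mat2_scaleR_left mat2_scaleR_right
     su2_basis_square sin_add cos_add algebra_simps)

lemma SU2_I: "mat 1 \<in> SU2"
  by (auto simp: SU2_def vec_eq_iff forall_2 mat_def matrix_matrix_mult_def sum_2 det_2)

text \<open>Unitarity and determinant 1 express the second column through the first, which is a unit
  vector.\<close>

lemma SU2_iff: "A \<in> SU2 \<longleftrightarrow> (\<exists>z. norm z = 1 \<and> A = sphere_to_SU2 z)"
proof
  assume "A \<in> SU2"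
  define a b c d where "a = A$1$1" "b = A$1$2" "c = A$2$1" "d = A$2$2"
  note abcd = this
  have eqs: "a * cnj a + b * cnj b = 1" "a * cnj c + b * cnj d = 0" "c * cnj a + d * cnj b = 0"
     "c * cnj c + d * cnj d = 1" "a * d - b * c = 1"
    using \<open>A \<in> SU2\<close> by (auto simp: SU2_def abcd vec_eq_iff forall_2 mat_def matrix_matrix_mult_def sum_2 det_2)
  \<comment> \<open>The norm of the first row supplies a factor 1; orthogonality of the rows then
    produces the determinant \<open>a * d - b * c\<close>.\<close>
  have "d = d * (a * cnj a + b * cnj b)" using eqs(1) by simp
  also have "\<dots> = cnj a * (a * d) + b * (d * cnj b)" by (simp add: algebra_simps)
  also have "d * cnj b = - (c * cnj a)" using eqs(3) by (simp add: add_eq_0_iff)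
  also have "cnj a * (a * d) + b * (- (c * cnj a)) = cnj a * (a * d - b * c)" by (simp add: algebra_simps)
  finally have 1: "d = cnj a" using eqs(5) by simp
  have "cnj c = cnj c * (a * d - b * c)" using eqs(5) by simp
  also have "\<dots> = d * (a * cnj c) - b * (c * cnj c)" by (simp add: algebra_simps)
  also have "a * cnj c = - (b * cnj d)" using eqs(2) by (simp add: add_eq_0_iff2)
  also have "d * - (b * cnj d) - b * (c * cnj c) = - b * (c * cnj c + d * cnj d)" by (simp add: algebra_simps)
  finally have 2: "b = - cnj c" using eqs(4) by simp
  have "complex_of_real ((cmod a)\<^sup>2 + (cmod c)\<^sup>2) = 1"
    using eqs(1) unfolding 2 of_real_add complex_norm_square by (simp add: mult.commute)
  then have "(cmod a)\<^sup>2 + (cmod c)\<^sup>2 = 1" using of_real_eq_1_iff by blast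
  then have "norm (vector [a, c] :: complex^2) = 1"
    by (simp add: norm_vec_def L2_set_def sum_2)
  moreover have "A = sphere_to_SU2 (vector [a, c])"
    using 1 2 by (simp add: sphere_to_SU2_def vec_eq_iff forall_2 abcd)
  ultimately show "\<exists>z. norm z = 1 \<and> A = sphere_to_SU2 z" by blast
next
  assume "\<exists>z. norm z = 1 \<and> A = sphere_to_SU2 z"
  then obtain z where z: "norm z = 1" "A = sphere_to_SU2 z" by blast
  then have "(cmod (z$1))\<^sup>2 + (cmod (z$2))\<^sup>2 = 1"
    by (simp add: norm_vec_def L2_set_def sum_2)
  then have "z$1 * cnj (z$1) + z$2 * cnj (z$2) = 1"
    by (metis complex_norm_square of_real_add of_real_1)
  then show "A \<in> SU2"
    by (simp add: SU2_def z sphere_to_SU2_def vec_eq_iff forall_2 mat_def matrix_matrix_mult_def sum_2 det_2 algebra_simps)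
qed

text \<open>Multiplicativity of the quaternion norm, that is, the four-square identity with one
  factor equal to 1.\<close>

lemma norm_mult_cplx2:
  fixes a b u v :: complex
  assumes "(cmod a)\<^sup>2 + (cmod b)\<^sup>2 = 1"
  shows "(cmod (a * u - b * cnj v))\<^sup>2 + (cmod (a * v + b * cnj u))\<^sup>2 = (cmod u)\<^sup>2 + (cmod v)\<^sup>2"
proof -
  have "(cmod (a * u - b * cnj v))\<^sup>2 + (cmod (a * v + b * cnj u))\<^sup>2 =
     ((cmod a)\<^sup>2 + (cmod b)\<^sup>2) * ((cmod u)\<^sup>2 + (cmod v)\<^sup>2)"
    unfolding cmod_power2 by (simp add: power2_eq_square algebra_simps)
  then show ?thesis using assms by simp
qed

text \<open>The first column of \<open>sphere_to_SU2 z ** sphere_to_SU2 w\<close>: right translation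
  of the group in the coordinates of the sphere. Because of the conjugates its linearity in
  \<open>z\<close> is over the reals.\<close>

definition right_mult :: "complex^2 \<Rightarrow> complex^2 \<Rightarrow> complex^2" where
  "right_mult w z = vector [w$1 * z$1 - w$2 * cnj (z$2), w$1 * z$2 + w$2 * cnj (z$1)]"

lemma linear_right_mult: "linear (right_mult w)"
  by (rule linearI) (simp_all add: right_mult_def vec_eq_iff forall_2 complex_eq_iff algebra_simps)

lemma norm_right_mult: "norm w = 1 \<Longrightarrow> norm (right_mult w z) = norm z"
  using norm_mult_cplx2[of "w$1" "w$2" "z$1" "z$2"]
  by (simp add: norm_vec_def L2_set_def sum_2 right_mult_def)

lemma sphere_to_SU2_mult:
  "sphere_to_SU2 z ** sphere_to_SU2 w = sphere_to_SU2 (right_mult w z)"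
  by (simp add: sphere_to_SU2_def right_mult_def vec_eq_iff forall_2 matrix_matrix_mult_def sum_2 algebra_simps)

lemma SU2_mult: "A \<in> SU2 \<Longrightarrow> B \<in> SU2 \<Longrightarrow> A ** B \<in> SU2"
  unfolding SU2_iff by (metis sphere_to_SU2_mult norm_right_mult)

lemma one_param_SU2: "one_param i s \<in> SU2"
proof -
  \<comment> \<open>\<open>w\<close> is the first column of \<open>one_param i s\<close>.\<close>
  define w :: "complex^2" where "w = vector [Complex (cos s) (if i = 1 then sin s else 0),
    Complex (if i = 2 then - sin s else 0) (if i = 3 then sin s else 0)]"
  have "norm w = 1"
    using exhaust_3[of i]
    by (auto simp: w_def norm_vec_def L2_set_def sum_2 cmod_power2)
  moreover have "one_param i s = sphere_to_SU2 w"
    using exhaust_3[of i]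
    by (auto simp: one_param_def su2_basis_def vec_eq_iff forall_2 mat_def sphere_to_SU2_def w_def
        complex_eq_iff)
  ultimately show ?thesis using SU2_iff by blast
qed

lemma linear_sphere_to_SU2: "linear sphere_to_SU2"
  by (rule linearI) (simp_all add: sphere_to_SU2_def vec_eq_iff forall_2 complex_eq_iff)

lemma compact_SU2: "compact SU2"
proof -
  have "SU2 = sphere_to_SU2 ` sphere 0 1"
    using SU2_iff by auto
  then show ?thesis
    using linear_sphere_to_SU2 compact_sphere
    by (metis compact_continuous_image linear_continuous_on linear_conv_bounded_linear)
qed

section \<open>The frame volume: finiteness, support and invariance\<close>

lemma frame_map_measurable: "(\<lambda>z. sphere_to_SU2 (z /\<^sub>R norm z)) \<in> borel_measurable borel"
proof -
  have "sphere_to_SU2 \<in> borel_measurable borel"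
    using linear_sphere_to_SU2
    by (simp add: linear_continuous_on linear_conv_bounded_linear borel_measurable_continuous_onI)
  moreover have "(\<lambda>z::complex^2. z /\<^sub>R norm z) \<in> borel_measurable borel" by measurable
  ultimately show ?thesis by measurable
qed

lemma sets_frame_volume [simp, measurable_cong]: "sets frame_volume = sets borel"
  and space_frame_volume [simp]: "space frame_volume = UNIV"
  by (auto simp: frame_volume_def)

lemma frame_density_measurable:
  "(\<lambda>z::complex^2. 4 * indicator (ball 0 1) z :: ennreal) \<in> borel_measurable lborel"
proof -
  have [measurable]: "ball (0::complex^2) 1 \<in> sets borel" by simp
  show ?thesis by simp
qed

lemma finite_measure_frame_volume: "finite_measure frame_volume"
proof (rule finite_measureI)
  have "emeasure frame_volume UNIV = emeasure (density lborel (\<lambda>z. 4 * indicator (ball (0::complex^2) 1) z)) UNIV"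
    unfolding frame_volume_def using frame_map_measurable by (subst emeasure_distr) auto
  also have "\<dots> = 4 * emeasure lborel (ball (0::complex^2) 1)"
    using frame_density_measurable by (subst emeasure_density) (auto simp: nn_integral_cmult_indicator)
  also have "\<dots> \<noteq> \<infinity>"
    using emeasure_lborel_ball_finite[of "0::complex^2" 1] by (simp add: ennreal_mult_eq_top_iff)
  finally show "emeasure frame_volume (space frame_volume) \<noteq> \<infinity>" by simp
qed

text \<open>Only the origin, where division by the norm 0 yields the zero matrix, is mapped outside
  \<open>SU2\<close>, and a point is a null set.\<close>

lemma AE_frame_volume_SU2: "AE p in frame_volume. p \<in> SU2"
proof -
  have "closed SU2" using compact_SU2 by (rule compact_imp_closed)
  then have [measurable]: "SU2 \<in> sets borel" by simp
  have "AE z in lborel. z \<noteq> (0::complex^2)" by (rule AE_lborel_singleton)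
  then have "AE z in lborel. sphere_to_SU2 (z /\<^sub>R norm z) \<in> SU2"
    by eventually_elim (auto simp: SU2_iff intro!: exI[of _ "_ /\<^sub>R _"])
  then show ?thesis
    unfolding frame_volume_def using frame_map_measurable frame_density_measurable
    by (subst AE_distr_iff) (auto simp: AE_density)
qed

lemma right_mult_scaleR: "right_mult w (c *\<^sub>R z) = c *\<^sub>R right_mult w z"
  using linear_right_mult by (rule linear_scale)

lemma continuous_on_matrix_mult_right:
  "continuous_on S (\<lambda>p::mat2. p ** (q::mat2))"
proof -
  have "linear (\<lambda>p::mat2. p ** (q::mat2))"
    by (rule linearI) (simp_all add: mat2_scaleR_left mat2_add_rdistrib)
  then show ?thesis by (simp add: linear_continuous_on linear_conv_bounded_linear)
qed

text \<open>Through the radial projection, right translation by \<open>q\<close> lifts to the linear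
  isometry \<open>right_mult w\<close>, which preserves both Lebesgue measure and the unit
  ball.\<close>

lemma frame_volume_right_invariant:
  fixes q :: mat2
  assumes "q \<in> SU2"
  shows "distr frame_volume borel (\<lambda>p::mat2. p ** q) = frame_volume"
proof -
  obtain w where w: "norm w = 1" "q = sphere_to_SU2 w" using assms SU2_iff by blast
  let ?B = "density lborel (\<lambda>z. 4 * indicator (ball (0::complex^2) 1) z)"
  let ?G = "\<lambda>z::complex^2. sphere_to_SU2 (z /\<^sub>R norm z)"
  let ?R = "right_mult w"
  note G = frame_map_measurable
  have M: "(\<lambda>p::mat2. p ** q) \<in> borel_measurable borel"
    by (rule borel_measurable_continuous_onI) (rule continuous_on_matrix_mult_right)
  have R: "?R \<in> borel_measurable borel"
    using linear_right_mult by (simp add: linear_continuous_on linear_conv_bounded_linear borel_measurable_continuous_onI)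
  have inv: "distr lborel borel ?R = lborel"
    using linear_right_mult norm_right_mult[OF w(1)] by (rule distr_lborel_isometry_complex2)
  \<comment> \<open>The density depends on the norm only, so it is unchanged by \<open>?R\<close>
    and can be moved outside the image measure.\<close>
  have "distr ?B borel ?R = density (distr lborel borel ?R) (\<lambda>z. 4 * indicator (ball 0 1) z)"
    using R norm_right_mult[OF w(1)] by (subst density_distr) (auto simp: indicator_def intro!: arg_cong[where f = "\<lambda>h. distr h borel _"] density_cong)
  then have B: "distr ?B borel ?R = ?B" by (simp add: inv)
  have "distr frame_volume borel (\<lambda>p. p ** q) = distr ?B borel ((\<lambda>p. p ** q) \<circ> ?G)"
    unfolding frame_volume_def using G M by (intro distr_distr) auto
  also have "(\<lambda>p. p ** q) \<circ> ?G = ?G \<circ> ?R"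
    by (auto simp: w sphere_to_SU2_mult right_mult_scaleR norm_right_mult[OF w(1)])
  also have "distr ?B borel (?G \<circ> ?R) = distr (distr ?B borel ?R) borel ?G"
    using G R by (intro distr_distr[symmetric]) auto
  also have "\<dots> = frame_volume" by (simp add: B frame_volume_def)
  finally show ?thesis .
qed


section \<open>Integration by parts along the frame\<close>

lemma set_integrable_frame_volume:
  fixes f :: "mat2 \<Rightarrow> real"
  assumes "S \<in> sets borel" "continuous_on S f" "\<And>p. p \<in> S \<Longrightarrow> \<bar>f p\<bar> \<le> M"
  shows "set_integrable frame_volume S f"
proof -
  interpret finite_measure frame_volume by (rule finite_measure_frame_volume)
  have "(\<lambda>p. indicator S p *\<^sub>R f p) \<in> borel_measurable borel"
    using assms by (intro borel_measurable_continuous_on_indicator) auto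
  then have "(\<lambda>p. indicator S p *\<^sub>R f p) \<in> borel_measurable frame_volume"
    by (simp cong: measurable_cong_sets)
  then show ?thesis
    unfolding set_integrable_def
    using assms(3) by (intro integrable_const_bound[where B = "\<bar>M\<bar>"] AE_I2) (force simp: indicator_def)+
qed

lemma SU2_borel [measurable]: "SU2 \<in> sets borel"
  using compact_SU2 by (simp add: compact_imp_closed)

lemma openin_SU2_borel: "openin (top_of_set SU2) U \<Longrightarrow> U \<in> sets borel"
  using SU2_borel by (auto simp: openin_open)

lemma set_integrable_SU2:
  fixes f :: "mat2 \<Rightarrow> real"
  assumes "continuous_on SU2 f"
  shows "set_integrable frame_volume SU2 f"
proof -
  have "bounded (f ` SU2)" using assms compact_SU2 compact_continuous_image compact_imp_bounded by blast
  then obtain M where "\<And>p. p \<in> SU2 \<Longrightarrow> \<bar>f p\<bar> \<le> M" by (auto simp: bounded_iff)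
  then show ?thesis using assms set_integrable_frame_volume SU2_borel by blast
qed

lemma continuous_on_one_param: "continuous_on S (\<lambda>s. p ** one_param i s)"
  unfolding one_param_def
  by (simp add: matrix_add_ldistrib mat2_scaleR_right) (intro continuous_intros)

lemma one_param_curve_add:
  "p ** one_param i (s + r) = (p ** one_param i s) ** one_param i r"
  by (simp add: one_param_add[symmetric] matrix_mul_assoc)

lemma eventually_one_param_in_open:
  assumes "openin (top_of_set SU2) U" "p \<in> U"
  shows "\<forall>\<^sub>F s in nhds 0. p ** one_param i s \<in> U"
proof -
  obtain T where T: "open T" "U = SU2 \<inter> T" using assms(1) by (auto simp: openin_open)
  have "open ((\<lambda>s. p ** one_param i s) -` T)"
    using T(1) continuous_on_one_param by (rule open_vimage)
  moreover have "0 \<in> (\<lambda>s. p ** one_param i s) -` T" using assms(2) T by simp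
  ultimately have "\<forall>\<^sub>F s in nhds 0. p ** one_param i s \<in> T"
    unfolding eventually_nhds by blast
  then show ?thesis
    by eventually_elim (use assms(2) T SU2_mult one_param_SU2 in auto)
qed

text \<open>By the group law the curve at time \<open>s\<close> restarts at
  \<open>p ** one_param i s\<close>, so derivatives at 0 for all base points give derivatives along
  the whole integral curve.\<close>

lemma DERIV_one_param_curve:
  assumes "((\<lambda>r. f ((p ** one_param i s) ** one_param i r)) has_real_derivative d) (at 0)"
  shows "((\<lambda>r. f (p ** one_param i r)) has_real_derivative d) (at s)"
  using assms DERIV_shift[of "\<lambda>r. f (p ** one_param i r)" d 0 s]
  by (simp add: one_param_curve_add[symmetric] add.commute)

text \<open>By right invariance the difference quotients of \<open>h\<close> along
  \<open>F\<^sub>i\<close> have integral 0. They converge to \<open>h'\<close>, and by the mean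
  value theorem they are dominated by the maximum of \<open>h'\<close> on the compact group.\<close>

lemma integral_frame_derivative_SU2:
  assumes h: "continuous_on SU2 h" "continuous_on SU2 h'"
    and D: "\<And>p. p \<in> SU2 \<Longrightarrow> ((\<lambda>s. h (p ** one_param i s)) has_real_derivative h' p) (at 0)"
  shows "(LINT p:SU2|frame_volume. h' p) = 0"
proof -
  interpret finite_measure frame_volume by (rule finite_measure_frame_volume)
  \<comment> \<open>Extension by zero gives a function on all matrices, where invariance of the
    measure applies.\<close>
  define H where "H p = indicator SU2 p *\<^sub>R h p" for p
  define q where "q n = one_param i (1 / real (Suc n))" for n
  define f where "f n p = (H (p ** q n) - H p) * real (Suc n)" for n p
  have intH: "integrable frame_volume H"
    using set_integrable_SU2[OF h(1)] by (simp add: set_integrable_def H_def[abs_def])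
  have qm: "(\<lambda>p. p ** q n) \<in> measurable frame_volume borel" for n
    using borel_measurable_continuous_onI[OF continuous_on_matrix_mult_right]
    by (simp cong: measurable_cong_sets)
  have Hm: "H \<in> borel_measurable borel"
    using borel_measurable_integrable[OF intH] by (simp cong: measurable_cong_sets)
  have inv: "distr frame_volume borel (\<lambda>p. p ** q n) = frame_volume" for n
    unfolding q_def using one_param_SU2 by (rule frame_volume_right_invariant)
  have intHq: "integrable frame_volume (\<lambda>p. H (p ** q n))" for n
    using integrable_distr_eq[OF qm Hm, of n] intH unfolding inv by simp
  have "integral\<^sup>L frame_volume (\<lambda>p. H (p ** q n)) = integral\<^sup>L frame_volume H" for n
    using integral_distr[OF qm Hm, of n] unfolding inv by simp
  then have f0: "integral\<^sup>L frame_volume (f n) = 0" for n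
    using intH intHq by (simp add: f_def[abs_def] Bochner_Integration.integral_diff)
  obtain M where M: "\<And>p. p \<in> SU2 \<Longrightarrow> \<bar>h' p\<bar> \<le> M"
    using compact_imp_bounded[OF compact_continuous_image[OF h(2) compact_SU2]]
    by (auto simp: bounded_iff)
  have fSU2: "f n p = (h (p ** q n) - h p) * real (Suc n)" if "p \<in> SU2" for n p
    using that SU2_mult[OF that] one_param_SU2 by (simp add: f_def H_def q_def)
  have lim: "(\<lambda>n. f n p) \<longlonglongrightarrow> h' p" if p: "p \<in> SU2" for p
  proof -
    have "((\<lambda>s. (h (p ** one_param i s) - h p) / s) \<longlongrightarrow> h' p) (at 0)"
      using D[OF p] by (simp add: has_field_derivative_iff)
    moreover have "filterlim (\<lambda>n. 1 / real (Suc n)) (at 0) sequentially"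
      unfolding filterlim_at using LIMSEQ_Suc[OF lim_1_over_n] by simp
    ultimately have "(\<lambda>n. (h (p ** one_param i (1 / real (Suc n))) - h p) / (1 / real (Suc n))) \<longlonglongrightarrow> h' p"
      by (rule filterlim_compose)
    then show ?thesis using p by (simp add: fSU2 q_def)
  qed
  have bound: "norm (f n p) \<le> M" if p: "p \<in> SU2" for n p
  proof -
    let ?k = "\<lambda>s. h (p ** one_param i s)"
    have dk: "(?k has_real_derivative h' (p ** one_param i s)) (at s)" for s
      by (rule DERIV_one_param_curve, rule D, rule SU2_mult, rule p, rule one_param_SU2)
    have "\<exists>z>0. z < 1 / real (Suc n) \<and>
        ?k (1 / real (Suc n)) - ?k 0 = (1 / real (Suc n) - 0) * h' (p ** one_param i z)"
      by (rule MVT2) (use dk in auto)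
    then obtain z where z: "?k (1 / real (Suc n)) - ?k 0 = (1 / real (Suc n) - 0) * h' (p ** one_param i z)"
      by auto
    then have "f n p = h' (p ** one_param i z)"
      using p by (simp add: fSU2 q_def)
    then show ?thesis using M[of "p ** one_param i z"] p SU2_mult one_param_SU2 by simp
  qed
  have inth': "set_integrable frame_volume SU2 h'" using h(2) by (rule set_integrable_SU2)
  have "(\<lambda>n. integral\<^sup>L frame_volume (f n)) \<longlonglongrightarrow> integral\<^sup>L frame_volume (\<lambda>p. indicator SU2 p *\<^sub>R h' p)"
  proof (rule integral_dominated_convergence)
    show "(\<lambda>p. indicator SU2 p *\<^sub>R h' p) \<in> borel_measurable frame_volume"
      using inth' unfolding set_integrable_def by (rule borel_measurable_integrable)
    show "f n \<in> borel_measurable frame_volume" for n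
        unfolding f_def[abs_def]
      using borel_measurable_integrable[OF intH] borel_measurable_integrable[OF intHq] by measurable
    show "integrable frame_volume (\<lambda>_. M)" by simp
    show "AE p in frame_volume. (\<lambda>n. f n p) \<longlonglongrightarrow> indicator SU2 p *\<^sub>R h' p"
      using AE_frame_volume_SU2 by eventually_elim (use lim in auto)
    show "AE p in frame_volume. norm (f n p) \<le> M" for n
      using AE_frame_volume_SU2 by eventually_elim (rule bound)
  qed
  then show ?thesis
    unfolding set_lebesgue_integral_def f0 using LIMSEQ_unique[OF tendsto_const] by fastforce
qed

text \<open>\<open>\<Omega>\<close> and \<open>SU2 - K\<close> form a relatively open cover of
  \<open>SU2\<close>, and the extension vanishes on the second set.\<close>

lemma continuous_on_extend_zero:
  fixes h :: "mat2 \<Rightarrow> real"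
  assumes \<Omega>: "openin (top_of_set SU2) \<Omega>" and K: "closed K" "K \<subseteq> \<Omega>"
    and h: "continuous_on \<Omega> h" "\<And>p. p \<in> \<Omega> - K \<Longrightarrow> h p = 0"
  shows "continuous_on SU2 (\<lambda>p. if p \<in> \<Omega> then h p else 0)"
proof -
  have sub: "\<Omega> \<subseteq> SU2" using \<Omega> openin_imp_subset by blast
  have eq: "SU2 = \<Omega> \<union> (SU2 - K)" using sub K by blast
  have "openin (top_of_set SU2) (SU2 - K)"
    using K(1) by (auto simp: Diff_eq openin_open)
  moreover have "continuous_on \<Omega> (\<lambda>p. if p \<in> \<Omega> then h p else 0)"
    using h(1) by (simp cong: continuous_on_cong)
  moreover have "continuous_on (SU2 - K) (\<lambda>p. if p \<in> \<Omega> then h p else 0)"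
    by (rule continuous_on_eq[of _ "\<lambda>_. 0"]) (use h(2) in auto)
  ultimately show ?thesis
    using continuous_on_Un_local_open[of \<Omega> "SU2 - K" "\<lambda>p. if p \<in> \<Omega> then h p else 0"] \<Omega>
    unfolding eq[symmetric] by blast
qed

text \<open>Extension by zero reduces this to the whole group: a point outside
  \<open>\<Omega>\<close> has a neighbourhood that misses \<open>K\<close>, on which the extension
  is identically 0.\<close>

lemma integral_frame_derivative:
  assumes \<Omega>: "openin (top_of_set SU2) \<Omega>" and K: "closed K" "K \<subseteq> \<Omega>"
    and h: "continuous_on \<Omega> h" "\<And>p. p \<in> \<Omega> - K \<Longrightarrow> h p = 0"
    and h': "continuous_on \<Omega> h'" "\<And>p. p \<in> \<Omega> - K \<Longrightarrow> h' p = 0"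
    and D: "\<And>p. p \<in> \<Omega> \<Longrightarrow> ((\<lambda>s. h (p ** one_param i s)) has_real_derivative h' p) (at 0)"
  shows "(LINT p:\<Omega>|frame_volume. h' p) = 0"
proof -
  let ?e = "\<lambda>f p. if p \<in> \<Omega> then f p else (0::real)"
  have sub: "\<Omega> \<subseteq> SU2" using \<Omega> openin_imp_subset by blast
  have "((\<lambda>s. ?e h (p ** one_param i s)) has_real_derivative ?e h' p) (at 0)" if p: "p \<in> SU2" for p
  proof (cases "p \<in> \<Omega>")
    case True
    have "\<forall>\<^sub>F s in nhds 0. ?e h (p ** one_param i s) = h (p ** one_param i s)"
      using eventually_one_param_in_open[OF \<Omega> True, of i] by eventually_elim simp
    then show ?thesis using D[OF True] True by (subst DERIV_cong_ev[OF refl _ refl]) auto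
  next
    case False
    have "openin (top_of_set SU2) (SU2 - K)"
      using K(1) by (auto simp: Diff_eq openin_open)
    then have "\<forall>\<^sub>F s in nhds 0. p ** one_param i s \<in> SU2 - K"
      using False p K by (intro eventually_one_param_in_open) auto
    then have "\<forall>\<^sub>F s in nhds 0. ?e h (p ** one_param i s) = 0"
      by eventually_elim (use h(2) in auto)
    then show ?thesis using False by (subst DERIV_cong_ev[OF refl _ refl]) auto
  qed
  then have "(LINT p:SU2|frame_volume. ?e h' p) = 0"
    using continuous_on_extend_zero[OF \<Omega> K h] continuous_on_extend_zero[OF \<Omega> K h']
    by (intro integral_frame_derivative_SU2[where h = "?e h" and i = i]) auto
  also have "(LINT p:SU2|frame_volume. ?e h' p) = (LINT p:\<Omega>|frame_volume. h' p)"
    unfolding set_lebesgue_integral_def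
    by (rule Bochner_Integration.integral_cong) (use sub in \<open>auto simp: indicator_def\<close>)
  finally show ?thesis .
qed

lemma set_integrable_compact_support:
  fixes h :: "mat2 \<Rightarrow> real"
  assumes \<Omega>: "openin (top_of_set SU2) \<Omega>" and K: "closed K" "K \<subseteq> \<Omega>"
    and h: "continuous_on \<Omega> h" "\<And>p. p \<in> \<Omega> - K \<Longrightarrow> h p = 0"
  shows "set_integrable frame_volume \<Omega> h"
proof -
  have "\<Omega> \<subseteq> SU2" using \<Omega> openin_imp_subset by blast
  then have "(\<lambda>p. indicator SU2 p *\<^sub>R (if p \<in> \<Omega> then h p else 0)) = (\<lambda>p. indicator \<Omega> p *\<^sub>R h p)"
    by (auto simp: fun_eq_iff indicator_def)
  then show ?thesis
    using set_integrable_SU2[OF continuous_on_extend_zero[OF assms]]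
    by (simp add: set_integrable_def)
qed


section \<open>Comparison of torsion functions\<close>

text \<open>
  \<open>cutoff e\<close> is a \<open>C\<^sup>1\<close> approximation of the identity from below that vanishes on \<open>{..e}\<close>. Its
  derivative \<open>cutoff' e s\<close> depends on \<open>e / s\<close> only, which makes two such functions comparable.
\<close>

definition cutoff :: "real \<Rightarrow> real \<Rightarrow> real" where
  "cutoff e s = (max s e - e)\<^sup>2 / max s e"

definition cutoff' :: "real \<Rightarrow> real \<Rightarrow> real" where
  "cutoff' e s = 1 - (e / max s e)\<^sup>2"

lemma cutoff_eq_0: "s \<le> e \<Longrightarrow> cutoff e s = 0" "0 < e \<Longrightarrow> s \<le> e \<Longrightarrow> cutoff' e s = 0"
  by (simp_all add: cutoff_def cutoff'_def)

lemma cutoff_bounds: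
  assumes "0 < e" "0 \<le> s"
  shows "0 \<le> cutoff e s" "cutoff e s \<le> s" "s - 2 * e \<le> cutoff e s"
proof -
  have "0 \<le> cutoff e s \<and> cutoff e s \<le> s \<and> s - 2 * e \<le> cutoff e s"
  proof (cases "s \<le> e")
    case True
    then show ?thesis using assms by (simp add: cutoff_eq_0)
  next
    case False
    then have s: "0 < s" "e < s" using assms by auto
    have "cutoff e s = s - 2 * e + e\<^sup>2 / s"
      using s by (simp add: cutoff_def max_def field_simps power2_eq_square)
    moreover have "e\<^sup>2 / s \<le> e" "0 \<le> e\<^sup>2 / s"
      using s assms by (simp_all add: field_simps power2_eq_square)
    moreover have "0 \<le> cutoff e s" using s by (simp add: cutoff_def)
    ultimately show ?thesis by linarith
  qed
  then show "0 \<le> cutoff e s" "cutoff e s \<le> s" "s - 2 * e \<le> cutoff e s" by blast+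
qed

lemma cutoff'_nonneg: "0 < e \<Longrightarrow> 0 \<le> cutoff' e s"
  by (simp add: cutoff'_def max_def divide_simps power_le_one)

text \<open>The last hypothesis says \<open>d / t \<le> e / s\<close> when \<open>s\<close> is
  positive: relative to its argument, the level \<open>d\<close> is the lower one.\<close>

lemma cutoff'_mono:
  assumes "0 < e" "0 < d" "0 < t" "d * s \<le> e * t"
  shows "cutoff' e s \<le> cutoff' d t"
proof (cases "s \<le> e")
  case True
  then show ?thesis using assms cutoff'_nonneg cutoff_eq_0 by simp
next
  case False
  have "e * d < d * s" using False assms by (simp add: mult.commute)
  then have "e * d < e * t" using assms by linarith
  then have "d < t" using assms by simp
  moreover have "d / t \<le> e / s" using assms False by (simp add: divide_simps mult.commute)
  then have "(d / t)\<^sup>2 \<le> (e / s)\<^sup>2" using assms by (intro power_mono) auto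
  ultimately show ?thesis using False by (simp add: cutoff'_def max_def)
qed

lemma continuous_on_cutoff:
  assumes "0 < e" "continuous_on S f"
  shows "continuous_on S (\<lambda>x. cutoff e (f x))" "continuous_on S (\<lambda>x. cutoff' e (f x))"
proof -
  have "max (f x) e \<noteq> 0" for x using assms(1) by (auto simp: max_def)
  then show "continuous_on S (\<lambda>x. cutoff e (f x))" "continuous_on S (\<lambda>x. cutoff' e (f x))"
    unfolding cutoff_def cutoff'_def using assms(2) by (auto intro!: continuous_intros)
qed

text \<open>Only \<open>s = e\<close> is delicate. There the numerator vanishes to second order, and
  the difference quotient is at most \<open>\<bar>x - e\<bar> / e\<close>.\<close>

lemma DERIV_cutoff:
  assumes e: "0 < e"
  shows "(cutoff e has_real_derivative cutoff' e s) (at s)"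
proof -
  consider "s < e" | "s > e" | "s = e" by linarith
  then show ?thesis
  proof cases
    case 1
    have "\<forall>\<^sub>F x in nhds s. x < e"
      using 1 by (intro eventually_nhds_in_open[of "{..<e}", simplified])
    then have "\<forall>\<^sub>F x in nhds s. cutoff e x = 0" by eventually_elim (simp add: cutoff_eq_0)
    then show ?thesis using 1 e by (subst DERIV_cong_ev[OF refl _ refl]) (auto simp: cutoff_eq_0)
  next
    case 2
    have "\<forall>\<^sub>F x in nhds s. x > e"
      using 2 by (intro eventually_nhds_in_open[of "{e<..}", simplified])
    then have "\<forall>\<^sub>F x in nhds s. cutoff e x = (x - e)\<^sup>2 / x"
      by eventually_elim (simp add: cutoff_def max_def)
    moreover have "((\<lambda>x. (x - e)\<^sup>2 / x) has_real_derivative cutoff' e s) (at s)"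
      using 2 e by (auto intro!: derivative_eq_intros simp: cutoff'_def max_def field_simps power2_eq_square)
    ultimately show ?thesis by (subst DERIV_cong_ev[OF refl _ refl]) auto
  next
    case 3
    have "((\<lambda>x. (cutoff e x - cutoff e e) / (x - e)) \<longlongrightarrow> 0) (at e)"
    proof (rule Lim_null_comparison)
      show "\<forall>\<^sub>F x in at e. norm ((cutoff e x - cutoff e e) / (x - e)) \<le> \<bar>x - e\<bar> / e"
        unfolding eventually_at_filter
      proof (rule always_eventually, intro allI impI)
        fix x assume "x \<noteq> e"
        show "norm ((cutoff e x - cutoff e e) / (x - e)) \<le> \<bar>x - e\<bar> / e"
        proof (cases "x \<le> e")
          case True
          then show ?thesis using e by (simp add: cutoff_eq_0)
        next
          case False
          then have eq: "(cutoff e x - cutoff e e) / (x - e) = (x - e) / x"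
            using e by (simp add: cutoff_eq_0(1)[of e e]) (simp add: cutoff_def max_def power2_eq_square)
          show ?thesis unfolding eq using False e by (simp add: frac_le)
        qed
      qed
      show "((\<lambda>x. \<bar>x - e\<bar> / e) \<longlongrightarrow> 0) (at e)"
        using e by (auto intro!: tendsto_eq_intros)
    qed
    then show ?thesis using 3 e by (simp add: has_field_derivative_iff cutoff_eq_0)
  qed
qed

section \<open>Positivity of torsion functions and testing of their equations\<close>

lemma Ck_on_2_continuous:
  assumes "Ck_on 2 U f"
  shows "continuous_on U f" "continuous_on U (frame_deriv i f)"
    "continuous_on U (frame_deriv j (frame_deriv i f))"
  using assms by (auto simp: numeral_2_eq_2)

lemma Ck_on_2_DERIV:
  assumes "Ck_on 2 U f" "p \<in> U"
  shows "((\<lambda>s. f (p ** one_param i s)) has_real_derivative frame_deriv i f p) (at 0)"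
    "((\<lambda>s. frame_deriv j f (p ** one_param i s)) has_real_derivative frame_deriv i (frame_deriv j f) p) (at 0)"
  using assms by (auto simp: numeral_2_eq_2 frame_deriv_def[of i] DERIV_deriv_iff_real_differentiable)

text \<open>Otherwise \<open>f'\<close> is negative just to the right of its zero at 0, and
  \<open>f\<close> drops below \<open>f 0\<close>.\<close>

lemma second_derivative_nonneg_at_min:
  fixes f :: "real \<Rightarrow> real"
  assumes D: "\<forall>\<^sub>F s in nhds 0. (f has_real_derivative f' s) (at s)"
    and D2: "(f' has_real_derivative d) (at 0)"
    and min: "\<forall>\<^sub>F s in nhds 0. f 0 \<le> f s"
  shows "0 \<le> d"
proof (rule ccontr)
  assume "\<not> 0 \<le> d"
  then obtain a where a: "a > 0" "\<And>h. 0 < h \<Longrightarrow> h < a \<Longrightarrow> f' h < f' 0"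
    using DERIV_neg_dec_right[OF D2] by auto
  obtain b where b: "b > 0" "\<And>s. \<bar>s\<bar> < b \<Longrightarrow> (f has_real_derivative f' s) (at s) \<and> f 0 \<le> f s"
    using eventually_conj[OF D min] by (auto simp: eventually_nhds_metric dist_real_def)
  have "f' 0 = 0"
    using b by (intro DERIV_local_min[of f "f' 0" 0 b]) auto
  define c where "c = min a b / 2"
  have c: "0 < c" "c < a" "c < b" using a b by (auto simp: c_def)
  have "\<exists>z>0. z < c \<and> f c - f 0 = (c - 0) * f' z"
    by (rule MVT2) (use b c in auto)
  then obtain z where z: "0 < z" "z < c" "f c - f 0 = c * f' z" by auto
  have "f' z < 0" using a(2)[of z] z c \<open>f' 0 = 0\<close> by auto
  then have "f c < f 0" using z c by (smt (verit) mult_pos_neg)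
  then show False using b(2)[of c] c by auto
qed

text \<open>The torsion problem of a diagonal left invariant metric; \<open>l\<close> stands for the
  reciprocals of the metric coefficients, and \<open>closure \<Omega> - \<Omega>\<close> is the
  boundary of an open set.\<close>

definition diag_torsion :: "(3 \<Rightarrow> real) \<Rightarrow> mat2 set \<Rightarrow> (mat2 \<Rightarrow> real) \<Rightarrow> bool" where
  "diag_torsion l \<Omega> E \<longleftrightarrow> continuous_on (closure \<Omega>) E \<and> Ck_on 2 \<Omega> E \<and>
     (\<forall>p\<in>\<Omega>. (\<Sum>i\<in>UNIV. l i * frame_deriv i (frame_deriv i E) p) = - 1) \<and>
     (\<forall>p\<in>closure \<Omega> - \<Omega>. E p = 0)"

lemma compact_closure_SU2:
  assumes "openin (top_of_set SU2) \<Omega>"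
  shows "compact (closure \<Omega>)"
  using assms compact_SU2 openin_imp_subset
  by (metis bounded_subset compact_closure compact_imp_bounded)

text \<open>Minimum principle: at an interior minimum all second frame derivatives are nonnegative,
  so their weighted sum cannot be -1.\<close>

lemma diag_torsion_pos:
  assumes \<Omega>: "openin (top_of_set SU2) \<Omega>" and E: "diag_torsion l \<Omega> E"
    and l: "\<And>i. 0 \<le> l i" and p: "p \<in> \<Omega>"
  shows "0 < E p"
proof -
  note E' = E[unfolded diag_torsion_def]
  have C2: "Ck_on 2 \<Omega> E" using E' by blast
  have no_min: "\<exists>q\<in>closure \<Omega>. E q < E m" if m: "m \<in> \<Omega>" for m
  proof (rule ccontr)
    assume "\<not> (\<exists>q\<in>closure \<Omega>. E q < E m)"
    then have min: "E m \<le> E q" if "q \<in> \<Omega>" for q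
      using that closure_subset by (metis not_le subsetD)
    have "0 \<le> frame_deriv i (frame_deriv i E) m" for i
    proof (rule second_derivative_nonneg_at_min)
      let ?c = "\<lambda>s. m ** one_param i s"
      have ev: "\<forall>\<^sub>F s in nhds 0. ?c s \<in> \<Omega>" using \<Omega> m by (rule eventually_one_param_in_open)
      show "((\<lambda>s. frame_deriv i E (?c s)) has_real_derivative frame_deriv i (frame_deriv i E) m) (at 0)"
        using C2 m by (rule Ck_on_2_DERIV)
      show "\<forall>\<^sub>F s in nhds 0. ((\<lambda>s. E (?c s)) has_real_derivative frame_deriv i E (?c s)) (at s)"
        using ev by eventually_elim (rule DERIV_one_param_curve, rule Ck_on_2_DERIV(1)[OF C2])
      show "\<forall>\<^sub>F s in nhds 0. E (?c 0) \<le> E (?c s)"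
        using ev by eventually_elim (use min in auto)
    qed
    then have "0 \<le> (\<Sum>i\<in>UNIV. l i * frame_deriv i (frame_deriv i E) m)"
      using l by (intro sum_nonneg mult_nonneg_nonneg) auto
    then show False using E' m by fastforce
  qed
  have "closure \<Omega> \<noteq> {}" using p closure_subset by blast
  then obtain m where m: "m \<in> closure \<Omega>" "\<And>q. q \<in> closure \<Omega> \<Longrightarrow> E m \<le> E q"
    using continuous_attains_inf[OF compact_closure_SU2[OF \<Omega>], of E] E' by blast
  \<comment> \<open>The minimum is therefore attained on the boundary and equals 0. Strictness
    follows since \<open>p\<close>, being interior, is not a minimum point.\<close>
  have "m \<notin> \<Omega>" using no_min m by (meson not_le)
  then have "E m = 0" using E' m by blast
  moreover obtain q where "q \<in> closure \<Omega>" "E q < E p" using no_min p by blast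
  ultimately show ?thesis using m(2)[of q] by simp
qed

text \<open>Integration by parts: the integrals of \<open>F\<^sub>i (v * F\<^sub>i u)\<close>
  vanish, and their weighted sum brings in the equation of \<open>u\<close>. Since \<open>v\<close>
  vanishes off \<open>K\<close>, the behaviour of the derivatives of \<open>u\<close> near the
  boundary does not matter.\<close>

lemma set_integral_weighted_laplacian_test:
  assumes \<Omega>: "openin (top_of_set SU2) \<Omega>" and K: "closed K" "K \<subseteq> \<Omega>"
    and v: "continuous_on \<Omega> v" "\<And>p. p \<in> \<Omega> - K \<Longrightarrow> v p = 0"
    and v': "\<And>i. continuous_on \<Omega> (v' i)" "\<And>i p. p \<in> \<Omega> - K \<Longrightarrow> v' i p = 0"
    and D: "\<And>i p. p \<in> \<Omega> \<Longrightarrow> ((\<lambda>s. v (p ** one_param i s)) has_real_derivative v' i p) (at 0)"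
    and u: "Ck_on 2 \<Omega> u" "\<And>p. p \<in> \<Omega> \<Longrightarrow> (\<Sum>i\<in>UNIV. l i * frame_deriv i (frame_deriv i u) p) = - 1"
  shows "set_integrable frame_volume \<Omega> v"
    and "set_integrable frame_volume \<Omega> (\<lambda>p. \<Sum>i\<in>UNIV. l i * v' i p * frame_deriv i u p)"
    and "(LINT p:\<Omega>|frame_volume. v p) =
      (LINT p:\<Omega>|frame_volume. (\<Sum>i\<in>UNIV. l i * v' i p * frame_deriv i u p))"
proof -
  let ?h' = "\<lambda>i p. v' i p * frame_deriv i u p + v p * frame_deriv i (frame_deriv i u) p"
  note cont = Ck_on_2_continuous[OF u(1)]
  have ch': "continuous_on \<Omega> (?h' i)" for i
    by (intro continuous_intros v v' cont)
  have I: "(LINT p:\<Omega>|frame_volume. ?h' i p) = 0" for i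
  proof (rule integral_frame_derivative[OF \<Omega> K, where h = "\<lambda>p. v p * frame_deriv i u p" and i = i])
    show "continuous_on \<Omega> (\<lambda>p. v p * frame_deriv i u p)" by (intro continuous_intros v v' cont)
    show "((\<lambda>s. v (p ** one_param i s) * frame_deriv i u (p ** one_param i s)) has_real_derivative ?h' i p) (at 0)"
      if "p \<in> \<Omega>" for p
      using DERIV_mult[OF D[OF that] Ck_on_2_DERIV(2)[OF u(1) that]] by (simp add: algebra_simps)
  qed (use ch' v v' in auto)
  have inth': "set_integrable frame_volume \<Omega> (?h' i)" for i
    using \<Omega> K ch' v(2) v'(2) by (intro set_integrable_compact_support[of \<Omega> K]) auto
  show intv: "set_integrable frame_volume \<Omega> v"
    using \<Omega> K v by (rule set_integrable_compact_support)
  show intr: "set_integrable frame_volume \<Omega> (\<lambda>p. \<Sum>i\<in>UNIV. l i * v' i p * frame_deriv i u p)" (is "set_integrable _ _ ?r")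
    using \<Omega> K v'(2) by (intro set_integrable_compact_support[of \<Omega> K]) (auto intro!: continuous_intros v' cont)
  have "(LINT p:\<Omega>|frame_volume. (\<Sum>i\<in>UNIV. l i * ?h' i p)) = (\<Sum>i\<in>UNIV. l i * (LINT p:\<Omega>|frame_volume. ?h' i p))"
    using inth' by (simp add: sum_3 set_integral_add(2) set_integral_add(1) set_integrable_mult_right
        del: distrib_left distrib_right)
  then have "0 = (LINT p:\<Omega>|frame_volume. (\<Sum>i\<in>UNIV. l i * ?h' i p))" unfolding I by simp
  also have "\<dots> = (LINT p:\<Omega>|frame_volume. ?r p - v p)"
  proof (rule set_lebesgue_integral_cong)
    show "\<Omega> \<in> sets frame_volume" using openin_SU2_borel[OF \<Omega>] by simp
    show "\<forall>p. p \<in> \<Omega> \<longrightarrow> (\<Sum>i\<in>UNIV. l i * ?h' i p) = ?r p - v p"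
    proof (intro allI impI)
      fix p assume "p \<in> \<Omega>"
      have "(\<Sum>i\<in>UNIV. l i * ?h' i p) = ?r p + v p * (\<Sum>i\<in>UNIV. l i * frame_deriv i (frame_deriv i u) p)"
        by (simp add: sum_3 algebra_simps)
      then show "(\<Sum>i\<in>UNIV. l i * ?h' i p) = ?r p - v p" using u(2)[OF \<open>p \<in> \<Omega>\<close>] by simp
    qed
  qed
  also have "\<dots> = (LINT p:\<Omega>|frame_volume. ?r p) - (LINT p:\<Omega>|frame_volume. v p)"
    using intr intv by (rule set_integral_diff)
  finally show "(LINT p:\<Omega>|frame_volume. v p) = (LINT p:\<Omega>|frame_volume. ?r p)" by simp
qed

text \<open>\<open>cutoff e (w p)\<close> is an admissible test function: it lives on
  \<open>{e \<le> w}\<close>, a closed set inside \<open>\<Omega>\<close> because \<open>w\<close>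
  is 0 on the boundary. Separate weights for \<open>w\<close> and \<open>u\<close> allow both
  energies and cross terms.\<close>

lemma diag_torsion_cutoff:
  assumes \<Omega>: "openin (top_of_set SU2) \<Omega>" and w: "diag_torsion l \<Omega> w" and e: "0 < e"
    and u: "diag_torsion k \<Omega> u"
  shows "set_integrable frame_volume \<Omega> (\<lambda>p. cutoff e (w p))"
    and "set_integrable frame_volume \<Omega>
      (\<lambda>p. \<Sum>i\<in>UNIV. k i * (cutoff' e (w p) * frame_deriv i w p) * frame_deriv i u p)"
    and "(LINT p:\<Omega>|frame_volume. cutoff e (w p)) = (LINT p:\<Omega>|frame_volume.
      (\<Sum>i\<in>UNIV. k i * (cutoff' e (w p) * frame_deriv i w p) * frame_deriv i u p))"
proof -
  define K where "K = {p \<in> closure \<Omega>. e \<le> w p}"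
  have cw: "continuous_on (closure \<Omega>) w" and Cw: "Ck_on 2 \<Omega> w" and w0: "\<And>p. p \<in> closure \<Omega> - \<Omega> \<Longrightarrow> w p = 0"
    using w by (auto simp: diag_torsion_def)
  have "closed K" unfolding K_def by (intro continuous_on_closed_Collect_le cw) auto
  moreover have "K \<subseteq> \<Omega>" using w0 e by (force simp: K_def)
  moreover have z: "w p \<le> e" if "p \<in> \<Omega> - K" for p
    using that closure_subset[of \<Omega>] by (auto simp: K_def)
  moreover have "continuous_on \<Omega> (\<lambda>p. cutoff e (w p))" "\<And>p. p \<in> \<Omega> - K \<Longrightarrow> cutoff e (w p) = 0"
    using continuous_on_cutoff(1)[OF e Ck_on_2_continuous(1)[OF Cw]] z cutoff_eq_0 by auto
  moreover have "continuous_on \<Omega> (\<lambda>p. cutoff' e (w p) * frame_deriv i w p)" for i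
    by (intro continuous_on_mult continuous_on_cutoff(2) e Ck_on_2_continuous[OF Cw])
  moreover have "cutoff' e (w p) * frame_deriv i w p = 0" if "p \<in> \<Omega> - K" for i p
    using cutoff_eq_0(2)[OF e z[OF that]] by simp
  moreover have "((\<lambda>s. cutoff e (w (p ** one_param i s))) has_real_derivative
      cutoff' e (w p) * frame_deriv i w p) (at 0)" if "p \<in> \<Omega>" for p i
    using DERIV_chain2[of "cutoff e" "cutoff' e (w p)" "\<lambda>s. w (p ** one_param i s)" 0 "frame_deriv i w p" UNIV]
      DERIV_cutoff[OF e, of "w p"] Ck_on_2_DERIV(1)[OF Cw that, of i] by simp
  moreover have "Ck_on 2 \<Omega> u" "\<And>p. p \<in> \<Omega> \<Longrightarrow> (\<Sum>i\<in>UNIV. k i * frame_deriv i (frame_deriv i u) p) = - 1"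
    using u by (auto simp: diag_torsion_def)
  moreover note T = set_integral_weighted_laplacian_test[OF \<Omega>, where K = K and
      v = "\<lambda>p. cutoff e (w p)" and v' = "\<lambda>i p. cutoff' e (w p) * frame_deriv i w p"
      and l = k and u = u]
  ultimately show "set_integrable frame_volume \<Omega> (\<lambda>p. cutoff e (w p))"
    and "set_integrable frame_volume \<Omega>
      (\<lambda>p. \<Sum>i\<in>UNIV. k i * (cutoff' e (w p) * frame_deriv i w p) * frame_deriv i u p)"
    and "(LINT p:\<Omega>|frame_volume. cutoff e (w p)) = (LINT p:\<Omega>|frame_volume.
      (\<Sum>i\<in>UNIV. k i * (cutoff' e (w p) * frame_deriv i w p) * frame_deriv i u p))"
    by - (rule T; assumption)+
qed

lemma diag_torsion_set_integrable:
  assumes \<Omega>: "openin (top_of_set SU2) \<Omega>" and E: "diag_torsion l \<Omega> E"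
  obtains M where "set_integrable frame_volume \<Omega> E" "0 < M" "\<And>p. p \<in> \<Omega> \<Longrightarrow> \<bar>E p\<bar> \<le> M"
proof -
  have "continuous_on (closure \<Omega>) E" using E by (simp add: diag_torsion_def)
  then have "bounded (E ` closure \<Omega>)"
    using compact_closure_SU2[OF \<Omega>] by (intro compact_imp_bounded compact_continuous_image)
  then obtain M where M: "0 < M" "\<And>p. p \<in> closure \<Omega> \<Longrightarrow> \<bar>E p\<bar> \<le> M" by (auto simp: bounded_pos)
  have M': "\<bar>E p\<bar> \<le> M" if "p \<in> \<Omega>" for p using M(2) that closure_subset by blast
  have "continuous_on \<Omega> E" using E Ck_on_2_continuous(1) by (auto simp: diag_torsion_def)
  then have "set_integrable frame_volume \<Omega> E"
    using openin_SU2_borel[OF \<Omega>] M' by (intro set_integrable_frame_volume)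
  then show ?thesis using M(1) M' by (rule that)
qed

text \<open>Young's inequality \<open>2 * (x * y) \<le> x\<^sup>2 / m + m * y\<^sup>2\<close>; then
  \<open>l / m \<le> k\<close> handles the first term and \<open>a \<le> b\<close> the
  second.\<close>

lemma weighted_cross_term_le:
  fixes x y :: real
  assumes "0 < m" "0 \<le> l" "l \<le> m * k" "0 \<le> a" "a \<le> b"
  shows "2 * (l * (a * x) * y) \<le> k * (a * x) * x + m * (l * (b * y) * y)"
proof -
  have "l * a * (2 * (x * y)) \<le> l * a * (x\<^sup>2 / m + m * y\<^sup>2)"
  proof (rule mult_left_mono)
    have "0 \<le> (x - m * y)\<^sup>2 / m" using assms by simp
    then show "2 * (x * y) \<le> x\<^sup>2 / m + m * y\<^sup>2" using assms by (simp add: power2_eq_square field_simps)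
  qed (use assms in simp)
  also have "\<dots> = (l / m) * (a * x\<^sup>2) + m * (l * y\<^sup>2) * a" by (simp add: algebra_simps)
  also have "\<dots> \<le> k * (a * x\<^sup>2) + m * (l * y\<^sup>2) * b"
    using assms by (intro add_mono mult_right_mono mult_left_mono) (auto simp: divide_simps mult.commute)
  finally show ?thesis by (simp add: power2_eq_square algebra_simps)
qed

text \<open>For reciprocal weights, \<open>l i \<le> m * k i\<close> says that the metric of
  \<open>w\<close> is at most \<open>m\<close> times that of \<open>E\<close>. The inequality is
  proved up to an arbitrary error \<open>r\<close>, caused by truncation.\<close>

lemma diag_torsion_integral_le:
  assumes \<Omega>: "openin (top_of_set SU2) \<Omega>"
    and w: "diag_torsion k \<Omega> w" and E: "diag_torsion l \<Omega> E"
    and m: "0 < m" and l: "\<And>i. 0 \<le> l i" and lk: "\<And>i. l i \<le> m * k i"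
  shows "(LINT p:\<Omega>|frame_volume. w p) \<le> m * (LINT p:\<Omega>|frame_volume. E p)"
proof (rule field_le_epsilon)
  \<comment> \<open>\<open>w\<close> is truncated at \<open>e\<close>, and \<open>E\<close> at a level \<open>d\<close> so low that
    \<open>cutoff' e (w p) \<le> cutoff' d (E p)\<close>; this lets the energy of the truncated \<open>E\<close> absorb the cross term.\<close>
  fix r :: real assume r: "0 < r"
  have k: "0 \<le> k i" for i
    using order_trans[OF l lk, of i] m by (simp add: zero_le_mult_iff)
  note posE = diag_torsion_pos[OF \<Omega> E l] and posw = diag_torsion_pos[OF \<Omega> w k]
  have sets: "\<Omega> \<in> sets frame_volume" using openin_SU2_borel[OF \<Omega>] by simp
  obtain M where M: "set_integrable frame_volume \<Omega> w" "0 < M" "\<And>p. p \<in> \<Omega> \<Longrightarrow> \<bar>w p\<bar> \<le> M"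
    using diag_torsion_set_integrable[OF \<Omega> w] by metis
  have intE: "set_integrable frame_volume \<Omega> E"
    using diag_torsion_set_integrable[OF \<Omega> E] by metis
  define V where "V = (LINT p:\<Omega>|frame_volume. (1::real))"
  have int1: "set_integrable frame_volume \<Omega> (\<lambda>_. 1::real)"
    using sets by (intro set_integrable_frame_volume[where M = 1]) auto
  have "0 \<le> V" unfolding V_def set_lebesgue_integral_def by (intro integral_nonneg_AE) auto
  \<comment> \<open>Truncating \<open>w\<close> at \<open>e\<close> costs at most
    \<open>2 * e * V\<close>, which this choice keeps below \<open>r\<close>; the summand 1 avoids
    division by 0.\<close>
  define e where "e = r / (2 * (V + 1))"
  have e: "0 < e" "2 * e * V \<le> r" using r \<open>0 \<le> V\<close> by (auto simp: e_def field_simps)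
  define K where "K = {p \<in> closure \<Omega>. e \<le> w p}"
  have cw: "continuous_on (closure \<Omega>) w" and cE: "continuous_on (closure \<Omega>) E"
    and w0: "\<And>p. p \<in> closure \<Omega> - \<Omega> \<Longrightarrow> w p = 0"
    using w E by (auto simp: diag_torsion_def)
  have "closed K" unfolding K_def by (intro continuous_on_closed_Collect_le cw) auto
  moreover have K\<Omega>: "K \<subseteq> \<Omega>" using w0 e by (force simp: K_def)
  ultimately have "compact K"
    using compact_Int_closed[OF compact_closure_SU2[OF \<Omega>], of K] closure_subset[of \<Omega>]
    by (simp add: Int_absorb1 subset_trans)
  \<comment> \<open>\<open>E\<close> is continuous and positive on the compact set
    \<open>K\<close>.\<close>
  have "\<exists>c>0. \<forall>p\<in>K. c \<le> E p"
  proof (cases "K = {}")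
    case True
    then show ?thesis by (auto intro: exI[of _ 1])
  next
    case False
    then obtain q where "q \<in> K" "\<forall>p\<in>K. E q \<le> E p"
      using continuous_attains_inf[OF \<open>compact K\<close>, of E] continuous_on_subset[OF cE, of K]
      by (auto simp: K_def)
    then show ?thesis using posE[of q] K\<Omega> by (intro exI[of _ "E q"]) auto
  qed
  then obtain c where c: "0 < c" "\<And>p. p \<in> K \<Longrightarrow> c \<le> E p" by blast
  \<comment> \<open>On \<open>K\<close> this gives
    \<open>d * w p \<le> d * M = e * c \<le> e * E p\<close>, the hypothesis of
    \<open>cutoff'_mono\<close>.\<close>
  define d where "d = e * c / M"
  have d: "0 < d" using e c M by (simp add: d_def)
  let ?v = "\<lambda>p. cutoff e (w p)" and ?z = "\<lambda>p. cutoff d (E p)"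
  let ?a = "\<lambda>p. cutoff' e (w p)" and ?b = "\<lambda>p. cutoff' d (E p)"
  note vE = diag_torsion_cutoff[OF \<Omega> w e(1) E]
  note vw = diag_torsion_cutoff[OF \<Omega> w e(1) w]
  note zE = diag_torsion_cutoff[OF \<Omega> E d E]
  have ab: "?a p \<le> ?b p" if p: "p \<in> \<Omega>" for p
  proof (cases "e \<le> w p")
    case True
    then have "p \<in> K" using p closure_subset by (auto simp: K_def)
    have "d * w p \<le> d * M" using M(3)[OF p] d by (intro mult_left_mono) auto
    also have "\<dots> = e * c" using M by (simp add: d_def)
    also have "\<dots> \<le> e * E p" using c(2)[OF \<open>p \<in> K\<close>] e by (intro mult_left_mono) auto
    finally show ?thesis using e d posE[OF p] by (intro cutoff'_mono)
  next
    case False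
    then show ?thesis using cutoff_eq_0(2)[of e "w p"] e d cutoff'_nonneg by simp
  qed
  have "2 * (LINT p:\<Omega>|frame_volume. ?v p) = (LINT p:\<Omega>|frame_volume.
      2 * (\<Sum>i\<in>UNIV. l i * (?a p * frame_deriv i w p) * frame_deriv i E p))"
    unfolding vE(3) by simp
  also have "\<dots> \<le> (LINT p:\<Omega>|frame_volume.
      (\<Sum>i\<in>UNIV. k i * (?a p * frame_deriv i w p) * frame_deriv i w p)
      + m * (\<Sum>i\<in>UNIV. l i * (?b p * frame_deriv i E p) * frame_deriv i E p))"
  proof (rule set_integral_mono)
    show "2 * (\<Sum>i\<in>UNIV. l i * (?a p * frame_deriv i w p) * frame_deriv i E p)
      \<le> (\<Sum>i\<in>UNIV. k i * (?a p * frame_deriv i w p) * frame_deriv i w p)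
      + m * (\<Sum>i\<in>UNIV. l i * (?b p * frame_deriv i E p) * frame_deriv i E p)" if "p \<in> \<Omega>" for p
      unfolding sum_distrib_left sum.distrib[symmetric]
      using m l lk e ab[OF that] cutoff'_nonneg by (intro sum_mono weighted_cross_term_le)
    show "set_integrable frame_volume \<Omega>
      (\<lambda>p. 2 * (\<Sum>i\<in>UNIV. l i * (?a p * frame_deriv i w p) * frame_deriv i E p))"
      using vE(2) by (intro set_integrable_mult_right)
    show "set_integrable frame_volume \<Omega>
      (\<lambda>p. (\<Sum>i\<in>UNIV. k i * (?a p * frame_deriv i w p) * frame_deriv i w p)
      + m * (\<Sum>i\<in>UNIV. l i * (?b p * frame_deriv i E p) * frame_deriv i E p))"
      using vw(2) zE(2) by (intro set_integral_add(1) set_integrable_mult_right)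
  qed
  \<comment> \<open>The first energy is again the integral of \<open>?v\<close>, by the equation of
    \<open>w\<close> tested with \<open>?v\<close>; it cancels one of the two copies on the
    left.\<close>
  also have "\<dots> = (LINT p:\<Omega>|frame_volume. ?v p) + m * (LINT p:\<Omega>|frame_volume. ?z p)"
    unfolding vw(3) zE(3) using vw(2) zE(2)
    by (simp only: set_integral_add(2) set_integrable_mult_right set_integral_mult_right)
  finally have "(LINT p:\<Omega>|frame_volume. ?v p) \<le> m * (LINT p:\<Omega>|frame_volume. ?z p)" by simp
  moreover have "(LINT p:\<Omega>|frame_volume. ?z p) \<le> (LINT p:\<Omega>|frame_volume. E p)"
    using zE(1) intE posE cutoff_bounds(2)[OF d] by (intro set_integral_mono) (auto simp: less_imp_le)
  then have "m * (LINT p:\<Omega>|frame_volume. ?z p) \<le> m * (LINT p:\<Omega>|frame_volume. E p)"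
    using m by simp
  moreover have "(LINT p:\<Omega>|frame_volume. w p) \<le> (LINT p:\<Omega>|frame_volume. ?v p + 2 * e * 1)"
    using M(1) vw(1) int1 cutoff_bounds(3)[OF e(1)] posw
    by (intro set_integral_mono set_integral_add(1) set_integrable_mult_right) (auto simp: less_imp_le algebra_simps)
  moreover have "(LINT p:\<Omega>|frame_volume. ?v p + 2 * e * 1) = (LINT p:\<Omega>|frame_volume. ?v p) + 2 * e * V"
    unfolding V_def using vw(1) int1
    by (simp only: set_integral_add(2) set_integrable_mult_right set_integral_mult_right)
  ultimately show "(LINT p:\<Omega>|frame_volume. w p) \<le> m * (LINT p:\<Omega>|frame_volume. E p) + r"
    using e(2) by linarith
qed


section \<open>Diagonal left invariant metrics\<close>

lemma frame_deriv_constant_on_SU2: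
  assumes "p \<in> SU2" "\<And>q. q \<in> SU2 \<Longrightarrow> f q = c"
  shows "frame_deriv i f p = 0"
  using assms SU2_mult one_param_SU2 by (simp add: frame_deriv_def)

lemma diag3_mult: "diag3 a b c ** diag3 a' b' c' = diag3 (a * a') (b * b') (c * c')"
  by (simp add: vec_eq_iff forall_3 matrix_matrix_mult_def sum_3 diag3_def)

lemma matrix_inv_diag3:
  assumes "a \<noteq> 0" "b \<noteq> 0" "c \<noteq> 0"
  shows "matrix_inv (diag3 a b c) = diag3 (1 / a) (1 / b) (1 / c)"
proof -
  let ?A = "diag3 a b c" and ?B = "diag3 (1 / a) (1 / b) (1 / c)"
  have "mat 1 = diag3 1 1 1" by (simp add: vec_eq_iff forall_3 mat_def diag3_def)
  then have inv: "?A ** ?B = mat 1" "?B ** ?A = mat 1"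
    using assms by (simp_all add: diag3_mult)
  then have "invertible ?A" unfolding invertible_def by blast
  then have "matrix_inv ?A ** ?A = mat 1"
    unfolding matrix_inv_def invertible_def by (rule someI2_ex) blast
  then have "matrix_inv ?A ** (?A ** ?B) = ?B" by (simp add: matrix_mul_assoc)
  then show ?thesis by (simp add: inv)
qed

lemma diag3_nth: "diag3 a b c $ i $ j = (if i \<noteq> j then 0 else if i = 1 then a else if i = 2 then b else c)"
  by (simp add: diag3_def)

lemma det_diag3: "det (diag3 a b c) = a * b * c"
  by (simp add: det_3 diag3_def)

text \<open>The form of \<open>g\<close> is prescribed on \<open>SU2\<close> only, since its values
  at other matrices carry no meaning.\<close>

locale left_invariant_diagonal =
  fixes g :: su2_tensor and a b c :: real
  assumes pos: "0 < a" "0 < b" "0 < c" and g: "\<And>p. p \<in> SU2 \<Longrightarrow> g p = diag3 a b c"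
begin

definition coef :: "3 \<Rightarrow> real" where
  "coef i = (if i = 1 then a else if i = 2 then b else c)"

lemma coef_simps [simp]: "coef 1 = a" "coef 2 = b" "coef 3 = c"
  by (simp_all add: coef_def)

lemma coef_pos: "0 < coef i"
  using pos by (simp add: coef_def)

text \<open>The coefficients are constant along the frame, so only the structure constants survive
  in Koszul's formula.\<close>

lemma christoffel_eq:
  assumes "p \<in> SU2"
  shows "christoffel g i j k p = struct_const i j k / 2 * (coef k + coef j - coef i) / coef k"
proof -
  have fd: "frame_deriv l (\<lambda>q. g q $ m $ n) p = 0" for l m n
    using assms g by (intro frame_deriv_constant_on_SU2[where c = "diag3 a b c $ m $ n"]) auto
  have "\<forall>i j k. christoffel g i j k p = struct_const i j k / 2 * (coef k + coef j - coef i) / coef k"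
    using pos unfolding forall_3 christoffel_def koszul_def fd g[OF assms]
    by (simp add: sum_3 matrix_inv_diag3 diag3_nth struct_const_def field_simps)
  then show ?thesis by blast
qed

text \<open>The diagonal trace sees only \<open>christoffel g i i k\<close>, which is 0 because
  \<open>struct_const i i k\<close> is; no first order term remains.\<close>

lemma laplacian_eq:
  assumes "p \<in> SU2"
  shows "laplacian g f p = (\<Sum>i\<in>UNIV. 1 / coef i * frame_deriv i (frame_deriv i f) p)"
  using pos unfolding laplacian_def christoffel_eq[OF assms] g[OF assms]
  by (simp add: sum_3 matrix_inv_diag3 diag3_nth struct_const_def)

text \<open>These are components on the frame vectors themselves, so each is the Ricci curvature in
  the unit direction times the metric coefficient.\<close>

lemma ricci_eq:
  assumes "p \<in> SU2"
  shows "ricci g p $ 1 $ 1 = 2 / (b * c) * (a\<^sup>2 - (b - c)\<^sup>2)"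
    and "ricci g p $ 2 $ 2 = 2 / (a * c) * (b\<^sup>2 - (a - c)\<^sup>2)"
    and "ricci g p $ 3 $ 3 = 2 / (a * b) * (c\<^sup>2 - (a - b)\<^sup>2)"
proof -
  have fd: "frame_deriv l (christoffel g i j k) p = 0" for i j k l
    using assms christoffel_eq by (intro frame_deriv_constant_on_SU2) auto
  show "ricci g p $ 1 $ 1 = 2 / (b * c) * (a\<^sup>2 - (b - c)\<^sup>2)"
    and "ricci g p $ 2 $ 2 = 2 / (a * c) * (b\<^sup>2 - (a - c)\<^sup>2)"
    and "ricci g p $ 3 $ 3 = 2 / (a * b) * (c\<^sup>2 - (a - b)\<^sup>2)"
    using pos unfolding ricci_def riemann_def fd christoffel_eq[OF assms]
    by (simp_all add: sum_3 struct_const_def) (simp_all add: field_simps power2_eq_square)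
qed

lemma torsion_function_diag:
  assumes \<Omega>: "openin (top_of_set SU2) \<Omega>" and E: "torsion_function g \<Omega> E"
  shows "diag_torsion (\<lambda>i. 1 / coef i) \<Omega> E"
proof -
  have sub: "\<Omega> \<subseteq> SU2" using \<Omega> openin_imp_subset by blast
  \<comment> \<open>\<open>SU2\<close> is closed, so the closure relative to it is the closure among
    all matrices.\<close>
  have "SU2_boundary \<Omega> = closure \<Omega> - \<Omega>"
  proof -
    have "(top_of_set SU2) closure_of \<Omega> = closure \<Omega>"
      using sub compact_SU2 closure_minimal[of \<Omega> SU2]
      by (auto simp: closure_of_subtopology Int_absorb1 compact_imp_closed)
    then show ?thesis using \<Omega> by (simp add: frontier_of_def interior_of_openin)
  qed
  then show ?thesis
    using E laplacian_eq[of _ E] subsetD[OF sub]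
    by (simp add: torsion_function_def diag_torsion_def)
qed

text \<open>The volume density is constant on \<open>SU2\<close>, and the complement of
  \<open>SU2\<close> is a null set.\<close>

lemma torsional_rigidity_eq:
  assumes \<Omega>: "openin (top_of_set SU2) \<Omega>" and E: "diag_torsion l \<Omega> E"
  shows "torsional_rigidity g \<Omega> E = sqrt (a * b * c) * (LINT p:\<Omega>|frame_volume. E p)"
proof -
  have "riemannian_volume g = density frame_volume (\<lambda>_. ennreal (sqrt (a * b * c)))"
  proof -
    have "(\<integral>\<^sup>+ p. ennreal (sqrt (det (g p))) * indicator A p \<partial>frame_volume)
        = (\<integral>\<^sup>+ p. ennreal (sqrt (a * b * c)) * indicator A p \<partial>frame_volume)" for A
      using AE_frame_volume_SU2
      by (intro nn_integral_cong_AE) (rule eventually_mono, auto simp: g det_diag3)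
    then show ?thesis by (simp add: riemannian_volume_def density_def)
  qed
  moreover have "(\<lambda>p. indicator \<Omega> p *\<^sub>R E p) \<in> borel_measurable frame_volume"
    using diag_torsion_set_integrable[OF \<Omega> E]
    unfolding set_integrable_def by (metis borel_measurable_integrable)
  ultimately have "torsional_rigidity g \<Omega> E
      = (LINT p|frame_volume. sqrt (a * b * c) * (indicator \<Omega> p *\<^sub>R E p))"
    using pos unfolding torsional_rigidity_def set_lebesgue_integral_def
    by (simp add: integral_density)
  then show ?thesis by (simp add: set_lebesgue_integral_def)
qed

end

text \<open>The exponent is 1 from the integral of the torsion function plus 3 / 2 from the volume
  density. Reciprocals turn \<open>a' \<le> r * a\<close> into the weight comparison with the roles
  exchanged.\<close>

lemma torsional_rigidity_le:
  assumes \<Omega>: "openin (top_of_set SU2) \<Omega>"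
    and g: "left_invariant_diagonal g a b c" and g': "left_invariant_diagonal g' a' b' c'"
    and E: "torsion_function g \<Omega> E" and E': "torsion_function g' \<Omega> E'"
    and r: "0 < r" "a' \<le> r * a" "b' \<le> r * b" "c' \<le> r * c"
  shows "torsional_rigidity g' \<Omega> E' \<le> r powr (5 / 2) * torsional_rigidity g \<Omega> E"
proof -
  interpret G: left_invariant_diagonal g a b c by fact
  interpret G': left_invariant_diagonal g' a' b' c' by fact
  note dE = G.torsion_function_diag[OF \<Omega> E] and dE' = G'.torsion_function_diag[OF \<Omega> E']
  let ?I = "LINT p:\<Omega>|frame_volume. E p" and ?I' = "LINT p:\<Omega>|frame_volume. E' p"
  have "G'.coef i \<le> r * G.coef i" for i
    using r by (simp add: G'.coef_def G.coef_def)
  then have "1 / G.coef i \<le> r * (1 / G'.coef i)" for i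
    using G.coef_pos[of i] G'.coef_pos[of i] by (simp add: field_simps)
  then have le: "?I' \<le> r * ?I"
    using G.coef_pos r by (intro diag_torsion_integral_le[OF \<Omega> dE' dE]) (auto simp: less_imp_le)
  have "0 < E p" if "p \<in> \<Omega>" for p
    using G.coef_pos that by (intro diag_torsion_pos[OF \<Omega> dE]) (auto simp: less_imp_le)
  \<comment> \<open>The sign of \<open>?I\<close> is needed to enlarge the volume factor in front of
    it.\<close>
  then have I: "0 \<le> ?I"
    unfolding set_lebesgue_integral_def by (intro integral_nonneg_AE) (auto simp: indicator_def less_imp_le)
  have "a' * b' * c' \<le> (r * a) * (r * b) * (r * c)"
    using r G.pos G'.pos by (intro mult_mono) auto
  also have "\<dots> = r ^ 3 * (a * b * c)" by (simp add: power3_eq_cube)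
  finally have vol: "sqrt (a' * b' * c') \<le> sqrt (r ^ 3) * sqrt (a * b * c)"
    unfolding real_sqrt_mult[symmetric] by (rule real_sqrt_le_mono)
  have "sqrt (a' * b' * c') * ?I' \<le> sqrt (a' * b' * c') * (r * ?I)"
    using G'.pos by (intro mult_left_mono le) simp
  also have "\<dots> \<le> (sqrt (r ^ 3) * sqrt (a * b * c)) * (r * ?I)"
    using I r(1) by (intro mult_right_mono vol) simp
  also have "\<dots> = (sqrt (r ^ 3) * r) * (sqrt (a * b * c) * ?I)" by simp
  also have "sqrt (r ^ 3) * r = r powr (5 / 2)"
  proof -
    have "sqrt (r ^ 3) * r = (r powr 3) powr (1 / 2) * r powr 1"
      using r(1) by (simp add: powr_half_sqrt powr_numeral)
    also have "\<dots> = r powr (5 / 2)"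
      unfolding powr_powr powr_add[symmetric] by simp
    finally show ?thesis .
  qed
  finally show ?thesis
    unfolding G.torsional_rigidity_eq[OF \<Omega> dE] G'.torsional_rigidity_eq[OF \<Omega> dE'] .
qed


section \<open>The ordinary differential equations of the flow\<close>

lemma DERIV_within_nonpos_imp_le:
  fixes f :: "real \<Rightarrow> real"
  assumes "a \<le> b"
    and D: "\<And>x. x \<in> {a..b} \<Longrightarrow> (f has_real_derivative f' x) (at x within {a..b})"
    and neg: "\<And>x. x \<in> {a..b} \<Longrightarrow> f' x \<le> 0"
  shows "f b \<le> f a"
proof (rule DERIV_nonpos_imp_decreasing_open[OF assms(1)])
  show "\<exists>y. (f has_real_derivative y) (at x) \<and> y \<le> 0" if "a < x" "x < b" for x
    using D[of x] neg[of x] that by (auto simp: at_within_Icc_at)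
  show "continuous_on {a..b} f" using D by (rule DERIV_continuous_on)
qed

text \<open>With \<open>H\<close> an antiderivative of \<open>h\<close>, the function
  \<open>y s * exp (- H s)\<close> is constant.\<close>

lemma linear_ODE_nonneg:
  fixes y h :: "real \<Rightarrow> real"
  assumes D: "\<And>s. s \<in> {0..t} \<Longrightarrow> (y has_real_derivative h s * y s) (at s within {0..t})"
    and h: "continuous_on {0..t} h" and y0: "0 \<le> y 0" and s: "s \<in> {0..t}"
  shows "0 \<le> y s"
proof -
  obtain H where H: "\<And>s. s \<in> {0..t} \<Longrightarrow> (H has_real_derivative h s) (at s within {0..t})"
    using antiderivative_continuous[OF h] by (auto simp: has_real_derivative_iff_has_vector_derivative)
  define f where "f s = y s * exp (- H s)" for s
  have "(f has_real_derivative 0) (at s within {0..t})" if "s \<in> {0..t}" for s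
    unfolding f_def[abs_def]
    by (rule DERIV_cong[OF DERIV_mult[OF D[OF that] DERIV_chain2[OF DERIV_exp DERIV_minus[OF H[OF that]]]]])
      (simp add: algebra_simps)
  then obtain c where "\<And>x. x \<in> {0..t} \<Longrightarrow> f x = c"
    using has_field_derivative_zero_constant[of "{0..t}" f] by auto
  then have "f s = f 0" using s by simp
  then have "y s * exp (- H s) = y 0 * exp (- H 0)" by (simp add: f_def)
  then have "0 \<le> y s * exp (- H s)" using y0 by simp
  then show ?thesis by (simp add: zero_le_mult_iff)
qed

text \<open>\<open>(b - c * s) powr k\<close> has logarithmic derivative
  \<open>- k * c / (b - c * s)\<close>; comparing it with that of \<open>X\<close> makes
  \<open>ln (X s) - k * ln (b - c * s)\<close> monotone.\<close>

lemma log_derivative_comparison: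
  fixes X :: "real \<Rightarrow> real"
  assumes t: "0 \<le> t" and b: "0 < b" "c * t < b" "0 \<le> c"
    and D: "\<And>s. s \<in> {0..t} \<Longrightarrow> (X has_real_derivative - (r s * X s)) (at s within {0..t})"
    and X: "\<And>s. s \<in> {0..t} \<Longrightarrow> 0 < X s"
  shows "(\<And>s. s \<in> {0..t} \<Longrightarrow> k * c / (b - c * s) \<le> r s) \<Longrightarrow> X t \<le> (1 - c * t / b) powr k * X 0"
    and "(\<And>s. s \<in> {0..t} \<Longrightarrow> r s \<le> k * c / (b - c * s)) \<Longrightarrow> (1 - c * t / b) powr k * X 0 \<le> X t"
proof -
  define f where "f s = ln (X s) - k * ln (b - c * s)" for s
  have bc: "0 < b - c * s" if "s \<in> {0..t}" for s
    using that b mult_left_mono[of s t c] by auto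
  have Df: "(f has_real_derivative (k * c / (b - c * s) - r s)) (at s within {0..t})" if "s \<in> {0..t}" for s
  proof -
    have "((\<lambda>s. ln (X s)) has_real_derivative 1 / X s * - (r s * X s)) (at s within {0..t})"
      using DERIV_chain2[of ln "1 / X s" X s "- (r s * X s)" "{0..t}"] DERIV_ln_divide[OF X[OF that]] D[OF that] by simp
    moreover have "((\<lambda>s. ln (b - c * s)) has_real_derivative 1 / (b - c * s) * (- c)) (at s within {0..t})"
      by (rule DERIV_chain2[of ln _ "\<lambda>s. b - c * s"], rule DERIV_ln_divide, rule bc[OF that])
        (auto intro!: derivative_eq_intros)
    ultimately have "(f has_real_derivative 1 / X s * - (r s * X s) - k * (1 / (b - c * s) * (- c))) (at s within {0..t})"
      unfolding f_def by (intro DERIV_diff DERIV_cmult)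
    then show ?thesis using X[OF that] by simp
  qed
  have X0: "0 < X 0" "0 < X t" using X t by auto
  have p: "0 < 1 - c * t / b" using b by (simp add: field_simps)
  have "1 - c * t / b = (b - c * t) / b" using b by (simp add: diff_divide_distrib)
  then have "ln (1 - c * t / b) = ln (b - c * t) - ln b"
    using b by (simp add: ln_div)
  moreover have "ln (P powr k * X 0) = k * ln P + ln (X 0)" if "0 < P" for P
    using that X0 by (simp add: ln_mult ln_powr)
  ultimately have ft: "f t - f 0 = ln (X t) - ln ((1 - c * t / b) powr k * X 0)"
    using p by (simp only: f_def right_diff_distrib) simp
  have pos: "0 < (1 - c * t / b) powr k * X 0"
    using X0 p by (metis less_irrefl mult_pos_pos powr_gt_zero)
  {
    assume *: "\<And>s. s \<in> {0..t} \<Longrightarrow> k * c / (b - c * s) \<le> r s"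
    have "f t \<le> f 0" by (rule DERIV_within_nonpos_imp_le[OF t Df]) (use * in auto)
    then show "X t \<le> (1 - c * t / b) powr k * X 0"
      using ft ln_le_cancel_iff[OF X0(2) pos] by simp
  }
  {
    assume *: "\<And>s. s \<in> {0..t} \<Longrightarrow> r s \<le> k * c / (b - c * s)"
    have "- f t \<le> - f 0" by (rule DERIV_within_nonpos_imp_le[OF t DERIV_minus[OF Df]]) (use * in auto)
    then have "0 \<le> f t - f 0" by simp
    then show "(1 - c * t / b) powr k * X 0 \<le> X t"
      using ft ln_le_cancel_iff[OF pos X0(2)] by simp
  }
qed

section \<open>Evolution of the metric coefficients\<close>

locale milnor_ricci_ode =
  fixes D B C :: "real \<Rightarrow> real" and t :: real
  assumes t: "0 \<le> t"
    and pos: "\<And>s. s \<in> {0..t} \<Longrightarrow> 0 < D s" "\<And>s. s \<in> {0..t} \<Longrightarrow> 0 < B s" "\<And>s. s \<in> {0..t} \<Longrightarrow> 0 < C s"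
    and DD: "\<And>s. s \<in> {0..t} \<Longrightarrow> (D has_real_derivative
        - (4 / (B s * C s) * ((D s)\<^sup>2 - (B s - C s)\<^sup>2))) (at s within {0..t})"
    and DB: "\<And>s. s \<in> {0..t} \<Longrightarrow> (B has_real_derivative
        - (4 / (D s * C s) * ((B s)\<^sup>2 - (D s - C s)\<^sup>2))) (at s within {0..t})"
    and DC: "\<And>s. s \<in> {0..t} \<Longrightarrow> (C has_real_derivative
        - (4 / (D s * B s) * ((C s)\<^sup>2 - (D s - B s)\<^sup>2))) (at s within {0..t})"
    and init: "D 0 \<le> C 0" "C 0 \<le> B 0"
begin

lemma continuous: "continuous_on {0..t} D" "continuous_on {0..t} B" "continuous_on {0..t} C"
  by (rule DERIV_continuous_on, erule DD DB DC)+

text \<open>Each of \<open>C - D\<close> and \<open>B - C\<close> solves a linear homogeneous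
  equation with continuous coefficient, so its initial sign persists.\<close>

lemma order:
  assumes s: "s \<in> {0..t}"
  shows "D s \<le> C s" "C s \<le> B s"
proof -
  have cont: "continuous_on {0..t} (\<lambda>s. - (4 / (B s * C s * D s) * ((X s + Y s)\<^sup>2 - (Z s)\<^sup>2)))"
    if "continuous_on {0..t} X" "continuous_on {0..t} Y" "continuous_on {0..t} Z" for X Y Z
    using pos by (intro continuous_intros that continuous) (auto simp: less_imp_neq[symmetric])
  have "0 \<le> C s - D s"
  proof (rule linear_ODE_nonneg[OF _ cont[of C D B] _ s])
    fix s assume s: "s \<in> {0..t}"
    show "((\<lambda>s. C s - D s) has_real_derivative
        - (4 / (B s * C s * D s) * ((C s + D s)\<^sup>2 - (B s)\<^sup>2)) * (C s - D s)) (at s within {0..t})"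
      using pos[OF s]
      by (intro DERIV_cong[OF DERIV_diff[OF DC[OF s] DD[OF s]]]) (simp add: field_simps power2_eq_square)
  qed (use init continuous in auto)
  then show "D s \<le> C s" by simp
  have "0 \<le> B s - C s"
  proof (rule linear_ODE_nonneg[OF _ cont[of B C D] _ s])
    fix s assume s: "s \<in> {0..t}"
    show "((\<lambda>s. B s - C s) has_real_derivative
        - (4 / (B s * C s * D s) * ((B s + C s)\<^sup>2 - (D s)\<^sup>2)) * (B s - C s)) (at s within {0..t})"
      using pos[OF s]
      by (intro DERIV_cong[OF DERIV_diff[OF DB[OF s] DC[OF s]]]) (simp add: field_simps power2_eq_square)
  qed (use init continuous in auto)
  then show "C s \<le> B s" by simp
qed

text \<open>Estimates proved at the right endpoint thereby hold at every intermediate time.\<close>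

lemma subinterval: "u \<in> {0..t} \<Longrightarrow> milnor_ricci_ode D B C u"
  using pos init DD DB DC
  by unfold_locales (auto intro: DERIV_subset[of _ _ _ "{0..t}"])

text \<open>The derivative of \<open>B / D\<close> has the factors \<open>B - D\<close> and
  \<open>B + D - C\<close>, whose signs come from \<open>order\<close>.\<close>

lemma pinching: "B t / D t \<le> B 0 / D 0"
proof (rule DERIV_within_nonpos_imp_le[OF t])
  fix s assume s: "s \<in> {0..t}"
  let ?d = "- (8 / (C s * (D s)\<^sup>2) * ((B s - D s) * (B s + D s - C s)))"
  show "((\<lambda>s. B s / D s) has_real_derivative ?d) (at s within {0..t})"
    using pos[OF s]
    by (intro DERIV_cong[OF DERIV_divide[OF DB[OF s] DD[OF s]]])
      (auto simp: field_simps power2_eq_square)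
  show "?d \<le> 0" using order[OF s] pos[OF s] by simp
qed

end

locale pinched_milnor_ricci_ode = milnor_ricci_ode +
  fixes \<delta> :: real
  assumes delta: "B 0 = (1 + \<delta>) * D 0" "\<delta> < 1"
begin

lemma delta_nonneg: "0 \<le> \<delta>"
proof -
  have "1 * D 0 \<le> (1 + \<delta>) * D 0" using delta init by simp
  then show ?thesis using pos(1)[of 0] t by simp
qed

lemma pinched:
  assumes s: "s \<in> {0..t}"
  shows "B s \<le> (1 + \<delta>) * D s"
proof -
  interpret S: milnor_ricci_ode D B C s using s by (rule subinterval)
  have "B s / D s \<le> 1 + \<delta>" using S.pinching delta pos(1)[of 0] t by simp
  then show ?thesis using pos(1)[OF s] by (simp add: field_simps)
qed

text \<open>Each bracket is the square of a coefficient, between the squares of \<open>D\<close> and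
  \<open>B\<close>, minus the square of a difference of size at most
  \<open>\<delta> * D s\<close>.\<close>

lemma bracket_bounds:
  assumes s: "s \<in> {0..t}"
    and q: "q \<in> {(D s)\<^sup>2 - (B s - C s)\<^sup>2, (B s)\<^sup>2 - (D s - C s)\<^sup>2, (C s)\<^sup>2 - (D s - B s)\<^sup>2}"
  shows "(1 - \<delta>\<^sup>2) * (D s)\<^sup>2 \<le> q" "q \<le> (B s)\<^sup>2"
proof -
  note o = order[OF s] and p = pinched[OF s] and pos' = pos[OF s]
  have sq: "x\<^sup>2 \<le> (\<delta> * D s)\<^sup>2" if "\<bar>x\<bar> \<le> \<delta> * D s" for x
    using that by (metis abs_le_square_iff abs_of_nonneg abs_ge_zero order_trans)
  have "(D s)\<^sup>2 \<le> (C s)\<^sup>2" "(C s)\<^sup>2 \<le> (B s)\<^sup>2" using o pos' by (auto intro: power_mono)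
  moreover have "(B s - C s)\<^sup>2 \<le> (\<delta> * D s)\<^sup>2" "(D s - C s)\<^sup>2 \<le> (\<delta> * D s)\<^sup>2" "(D s - B s)\<^sup>2 \<le> (\<delta> * D s)\<^sup>2"
    using o p by (intro sq; simp add: algebra_simps)+
  moreover have "(1 - \<delta>\<^sup>2) * (D s)\<^sup>2 = (D s)\<^sup>2 - (\<delta> * D s)\<^sup>2"
    by (simp add: algebra_simps power_mult_distrib)
  moreover have "0 \<le> (B s - C s)\<^sup>2" "0 \<le> (D s - C s)\<^sup>2" "0 \<le> (D s - B s)\<^sup>2" by simp_all
  ultimately have "(1 - \<delta>\<^sup>2) * (D s)\<^sup>2 \<le> q \<and> q \<le> (B s)\<^sup>2"
    using q unfolding insert_iff empty_iff by (elim disjE FalseE; intro conjI; linarith)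
  then show "(1 - \<delta>\<^sup>2) * (D s)\<^sup>2 \<le> q" "q \<le> (B s)\<^sup>2" by blast+
qed

lemma B_bounds: "B t \<le> B 0 - 4 * t" "B 0 - 4 * (1 + 6 * \<delta>) * t \<le> B t"
proof -
  have "B t + 4 * t \<le> B 0 + 4 * 0"
  proof (rule DERIV_within_nonpos_imp_le[OF t])
    fix s assume s: "s \<in> {0..t}"
    let ?d = "- (4 / (D s * C s) * ((B s)\<^sup>2 - (D s - C s)\<^sup>2)) + 4"
    show "((\<lambda>s. B s + 4 * s) has_real_derivative ?d) (at s within {0..t})"
      by (auto intro!: derivative_eq_intros DB[OF s])
    \<comment> \<open>The bracket factors as a difference of squares; the factors are at least
      \<open>D s\<close> and \<open>C s\<close> by the ordering, so \<open>B\<close> decreases at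
      rate at least 4.\<close>
    have "D s * C s \<le> (B s - C s + D s) * (B s + C s - D s)"
      using order[OF s] pos[OF s] by (intro mult_mono) auto
    then have "D s * C s \<le> (B s)\<^sup>2 - (D s - C s)\<^sup>2" by (simp add: power2_eq_square algebra_simps)
    then show "?d \<le> 0" using pos[OF s] by (simp add: field_simps)
  qed
  then show "B t \<le> B 0 - 4 * t" by simp
  have "- B t - 4 * (1 + 6 * \<delta>) * t \<le> - B 0 - 4 * (1 + 6 * \<delta>) * 0"
  proof (rule DERIV_within_nonpos_imp_le[OF t])
    fix s assume s: "s \<in> {0..t}"
    let ?d = "4 / (D s * C s) * ((B s)\<^sup>2 - (D s - C s)\<^sup>2) - 4 * (1 + 6 * \<delta>)"
    show "((\<lambda>s. - B s - 4 * (1 + 6 * \<delta>) * s) has_real_derivative ?d) (at s within {0..t})"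
      by (auto intro!: derivative_eq_intros DB[OF s])
    have "(B s)\<^sup>2 - (D s - C s)\<^sup>2 \<le> (B s)\<^sup>2" by simp
    also have "\<dots> \<le> ((1 + \<delta>) * D s)\<^sup>2" using pinched[OF s] pos[OF s] by (intro power_mono) auto
    also have "\<dots> = (1 + \<delta>)\<^sup>2 * (D s * D s)" by (simp add: power_mult_distrib power2_eq_square)
    also have "\<dots> \<le> (1 + 6 * \<delta>) * (D s * C s)"
    proof (intro mult_mono)
      \<comment> \<open>As \<delta> < 1, the square is at most \<open>1 + 3 * \<delta>\<close>, well
        within the constant of the statement.\<close>
      have "\<delta> * \<delta> \<le> \<delta> * 1" using delta delta_nonneg by (intro mult_left_mono) auto
      then show "(1 + \<delta>)\<^sup>2 \<le> 1 + 6 * \<delta>" using delta_nonneg by (simp add: power2_eq_square algebra_simps)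
    qed (use order[OF s] pos[OF s] delta_nonneg in auto)
    finally show "?d \<le> 0" using pos[OF s] by (simp add: field_simps)
  qed
  then show "B 0 - 4 * (1 + 6 * \<delta>) * t \<le> B t" by simp
qed

lemma B_bounds_within:
  assumes s: "s \<in> {0..t}"
  shows "B s \<le> B 0 - 4 * s" "B 0 - 4 * (1 + 6 * \<delta>) * s \<le> B s"
proof -
  interpret S: milnor_ricci_ode D B C s using s by (rule subinterval)
  interpret S: pinched_milnor_ricci_ode D B C s \<delta> by unfold_locales (rule delta)+
  show "B s \<le> B 0 - 4 * s" "B 0 - 4 * (1 + 6 * \<delta>) * s \<le> B s" by (rule S.B_bounds)+
qed

text \<open>All three coefficients decay at a logarithmic rate \<open>4 * q / (B * C * D)\<close>
  with \<open>q\<close> one of the brackets. Bounding \<open>q\<close> by multiples of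
  \<open>C * D\<close> leaves multiples of \<open>1 / B\<close>, and the linear bounds on
  \<open>B\<close> give the rates for \<open>log_derivative_comparison\<close>.\<close>

lemma ratio_bounds_aux:
  assumes time: "4 * (1 + 6 * \<delta>) * t < B 0"
    and X: "\<And>s. s \<in> {0..t} \<Longrightarrow> 0 < X s"
    and DX: "\<And>s. s \<in> {0..t} \<Longrightarrow>
      (X has_real_derivative - (4 / (B s * C s * D s) * q s * X s)) (at s within {0..t})"
    and q: "\<And>s. s \<in> {0..t} \<Longrightarrow> q s \<in> {(D s)\<^sup>2 - (B s - C s)\<^sup>2, (B s)\<^sup>2 - (D s - C s)\<^sup>2, (C s)\<^sup>2 - (D s - B s)\<^sup>2}"
  shows "X t \<le> (1 - 4 * t / B 0) powr ((1 - \<delta>) / (1 + \<delta>)) * X 0"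
    and "(1 - 4 * (1 + 6 * \<delta>) * t / B 0) powr ((1 + \<delta>) ^ 3 / (1 + 6 * \<delta>)) * X 0 \<le> X t"
proof -
  have B0: "0 < B 0" using pos t by simp
  note \<delta>0 = delta_nonneg
  have "4 * t \<le> 4 * (1 + 6 * \<delta>) * t" using \<delta>0 t by (simp add: algebra_simps)
  then have time': "4 * t < B 0" using time by linarith
  have cancel': "a / k * (4 * k) / e = 4 * a / e" if "k \<noteq> 0" for a k e :: real
    using that by simp
  have cancel: "k * 4 / b = 4 / (b * c * d) * (k * (c * d))" if "0 < b" "0 < c" "0 < d" for k b c d :: real
    using that by (simp add: field_simps)
  show "X t \<le> (1 - 4 * t / B 0) powr ((1 - \<delta>) / (1 + \<delta>)) * X 0"
  proof (rule log_derivative_comparison(1)[OF t B0 time' _ DX X])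
    fix s assume s: "s \<in> {0..t}"
    note pos' = pos[OF s]
    \<comment> \<open>Pinching bounds \<open>C s * D s\<close> by
      \<open>((1 + \<delta>) * D s)\<^sup>2\<close>, and the prefactor turns this into the lower
      bound for the brackets.\<close>
    have "(1 - \<delta>) / (1 + \<delta>) * (C s * D s) \<le> (1 - \<delta>) / (1 + \<delta>) * ((1 + \<delta>) * D s * ((1 + \<delta>) * D s))"
    proof (intro mult_left_mono mult_mono)
      show "C s \<le> (1 + \<delta>) * D s" using order(2)[OF s] pinched[OF s] by simp
      show "D s \<le> (1 + \<delta>) * D s" using \<delta>0 pos' by (simp add: algebra_simps)
    qed (use delta \<delta>0 pos' in auto)
    also have "\<dots> = (1 - \<delta>\<^sup>2) * (D s)\<^sup>2" using \<delta>0 by (simp add: field_simps power2_eq_square)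
    also have "\<dots> \<le> q s" using bracket_bounds(1)[OF s q[OF s]] .
    finally have q_ge: "(1 - \<delta>) / (1 + \<delta>) * (C s * D s) \<le> q s" .
    have "(1 - \<delta>) / (1 + \<delta>) * 4 / (B 0 - 4 * s) \<le> (1 - \<delta>) / (1 + \<delta>) * 4 / B s"
      using B_bounds_within(1)[OF s] pos' delta \<delta>0 by (intro divide_left_mono mult_pos_pos) auto
    also have "\<dots> = 4 / (B s * C s * D s) * ((1 - \<delta>) / (1 + \<delta>) * (C s * D s))"
      using cancel pos' by blast
    also have "\<dots> \<le> 4 / (B s * C s * D s) * q s"
      using pos' q_ge by (intro mult_left_mono) auto
    finally show "(1 - \<delta>) / (1 + \<delta>) * 4 / (B 0 - 4 * s) \<le> 4 / (B s * C s * D s) * q s" .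
  qed simp
  show "(1 - 4 * (1 + 6 * \<delta>) * t / B 0) powr ((1 + \<delta>) ^ 3 / (1 + 6 * \<delta>)) * X 0 \<le> X t"
  proof (rule log_derivative_comparison(2)[OF t B0 time _ DX X])
    fix s assume s: "s \<in> {0..t}"
    note pos' = pos[OF s]
    have "4 * (1 + 6 * \<delta>) * s \<le> 4 * (1 + 6 * \<delta>) * t" using s \<delta>0 by (intro mult_left_mono) auto
    then have B0s: "0 < B 0 - 4 * (1 + 6 * \<delta>) * s" using time by linarith
    have "4 / (B s * C s * D s) * q s \<le> 4 / (B s * C s * D s) * ((B s)\<^sup>2)"
      using pos' bracket_bounds(2)[OF s q[OF s]] by (intro mult_left_mono) auto
    also have "\<dots> \<le> 4 / (B s * C s * D s) * ((1 + \<delta>)\<^sup>2 * (C s * D s))"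
    proof (intro mult_left_mono)
      have "(B s)\<^sup>2 \<le> ((1 + \<delta>) * D s)\<^sup>2" using pinched[OF s] pos' by (intro power_mono) auto
      also have "\<dots> = (1 + \<delta>)\<^sup>2 * (D s * D s)" by (simp add: power2_eq_square)
      also have "\<dots> \<le> (1 + \<delta>)\<^sup>2 * (C s * D s)" using order[OF s] pos' by (intro mult_left_mono mult_right_mono) auto
      finally show "(B s)\<^sup>2 \<le> (1 + \<delta>)\<^sup>2 * (C s * D s)" .
    qed (use pos' in auto)
    also have "\<dots> = 4 * (1 + \<delta>)\<^sup>2 / B s" using pos' by (simp add: field_simps)
    \<comment> \<open>Besides the lower bound on \<open>B\<close>, the square is weakened to a cube,
      the exponent in the statement.\<close>
    also have "\<dots> \<le> 4 * (1 + \<delta>) ^ 3 / (B 0 - 4 * (1 + 6 * \<delta>) * s)"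
      using B_bounds_within(2)[OF s] B0s pos' \<delta>0 by (intro frac_le mult_left_mono power_increasing) auto
    also have "\<dots> = (1 + \<delta>) ^ 3 / (1 + 6 * \<delta>) * (4 * (1 + 6 * \<delta>)) / (B 0 - 4 * (1 + 6 * \<delta>) * s)"
      by (rule cancel'[symmetric]) (use \<delta>0 in simp)
    finally show "4 / (B s * C s * D s) * q s
        \<le> (1 + \<delta>) ^ 3 / (1 + 6 * \<delta>) * (4 * (1 + 6 * \<delta>)) / (B 0 - 4 * (1 + 6 * \<delta>) * s)" .
  qed (use \<delta>0 in simp)
qed

lemma ratio_bounds:
  assumes time: "4 * (1 + 6 * \<delta>) * t < B 0" and X: "X \<in> {D, B, C}"
  shows "X t \<le> (1 - 4 * t / B 0) powr ((1 - \<delta>) / (1 + \<delta>)) * X 0"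
    and "(1 - 4 * (1 + 6 * \<delta>) * t / B 0) powr ((1 + \<delta>) ^ 3 / (1 + 6 * \<delta>)) * X 0 \<le> X t"
proof -
  \<comment> \<open>If two of the functions coincide, so do their brackets; hence the order of the
    cases is harmless.\<close>
  define q where "q s = (if X = D then (D s)\<^sup>2 - (B s - C s)\<^sup>2
    else if X = B then (B s)\<^sup>2 - (D s - C s)\<^sup>2 else (C s)\<^sup>2 - (D s - B s)\<^sup>2)" for s
  have "(X has_real_derivative - (4 / (B s * C s * D s) * q s * X s)) (at s within {0..t})" if s: "s \<in> {0..t}" for s
    using X DERIV_cong[OF DD[OF s], of "- (4 / (B s * C s * D s) * q s * X s)"]
      DERIV_cong[OF DB[OF s], of "- (4 / (B s * C s * D s) * q s * X s)"]
      DERIV_cong[OF DC[OF s], of "- (4 / (B s * C s * D s) * q s * X s)"] pos[OF s]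
    by (auto simp: q_def split: if_splits)
  moreover have "0 < X s" if "s \<in> {0..t}" for s using X pos that by auto
  moreover have "q s \<in> {(D s)\<^sup>2 - (B s - C s)\<^sup>2, (B s)\<^sup>2 - (D s - C s)\<^sup>2, (C s)\<^sup>2 - (D s - B s)\<^sup>2}" for s
    by (simp add: q_def)
  ultimately show "X t \<le> (1 - 4 * t / B 0) powr ((1 - \<delta>) / (1 + \<delta>)) * X 0"
    and "(1 - 4 * (1 + 6 * \<delta>) * t / B 0) powr ((1 + \<delta>) ^ 3 / (1 + 6 * \<delta>)) * X 0 \<le> X t"
    by - (rule ratio_bounds_aux[OF time, of X q]; assumption)+
qed

end


section \<open>Torsional rigidity along the flow\<close>

lemma diag3_eq_iff: "diag3 a b c = diag3 a' b' c' \<longleftrightarrow> a = a' \<and> b = b' \<and> c = c'"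
  by (auto simp: vec_eq_iff forall_3 diag3_nth)

text \<open>Positive definiteness at the identity, applied to the coordinate vectors, makes the
  coefficients positive.\<close>

lemma ricci_flow_left_invariant_diagonal:
  assumes flow: "ricci_flow g T" and s: "0 \<le> s" "ereal s < T"
    and diagonal: "\<And>p. p \<in> SU2 \<Longrightarrow> g s p = diag3 a b c"
  shows "left_invariant_diagonal (g s) a b c"
proof -
  have "v \<bullet> (diag3 a b c *v v) > 0" if "v \<noteq> 0" for v
  proof -
    have "riemannian_metric (g s)" using flow s by (simp add: ricci_flow_def)
    then have "v \<bullet> (g s (mat 1) *v v) > 0" using that SU2_I by (simp add: riemannian_metric_def)
    then show ?thesis by (simp add: diagonal[OF SU2_I])
  qed
  from this[of "axis 1 1"] this[of "axis 2 1"] this[of "axis 3 1"]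
  have "0 < a" "0 < b" "0 < c"
    by (auto simp: inner_vec_def sum_3 matrix_vector_mult_def diag3_nth axis_def vec_eq_iff split: if_splits)
  then show ?thesis using diagonal by (simp add: left_invariant_diagonal_def)
qed

text \<open>The equations are the diagonal entries of the flow equation at the identity matrix; the
  constant 4 is 2 from the flow times 2 from the curvature.\<close>

lemma ricci_flow_milnor_ode:
  assumes flow: "ricci_flow g T" and t: "0 \<le> t" "ereal t < T"
    and diagonal: "\<And>s p. 0 \<le> s \<Longrightarrow> ereal s < T \<Longrightarrow> p \<in> SU2 \<Longrightarrow> g s p = diag3 (D s) (B s) (C s)"
    and init: "D 0 \<le> C 0" "C 0 \<le> B 0"
  shows "milnor_ricci_ode D B C t"
proof unfold_locales
  have I: "0 \<le> s" "ereal s < T" if "s \<in> {0..t}" for s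
    using that le_less_trans[OF _ t(2), of "ereal s"] by simp_all
  have inv: "left_invariant_diagonal (g s) (D s) (B s) (C s)" if "s \<in> {0..t}" for s
    using I[OF that] diagonal[OF I[OF that]] by (rule ricci_flow_left_invariant_diagonal[OF flow])
  have comp: "((\<lambda>s. diag3 (D s) (B s) (C s) $ i $ i) has_real_derivative - 2 * ricci (g s) (mat 1) $ i $ i)
      (at s within {0..t})" if s: "s \<in> {0..t}" for s i
  proof -
    have "((\<lambda>s. g s (mat 1)) has_vector_derivative - 2 *\<^sub>R ricci (g s) (mat 1)) (at s within {0..})"
      using flow I[OF s] SU2_I unfolding ricci_flow_def by blast
    then have "((\<lambda>s. g s (mat 1)) has_vector_derivative - 2 *\<^sub>R ricci (g s) (mat 1)) (at s within {0..t})"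
      by (rule has_vector_derivative_within_subset) auto
    note bounded_linear.has_vector_derivative[OF bounded_linear_vec_nth[of i], OF
        bounded_linear.has_vector_derivative[OF bounded_linear_vec_nth[of i] this]]
    then have "((\<lambda>s. g s (mat 1) $ i $ i) has_real_derivative - 2 * ricci (g s) (mat 1) $ i $ i) (at s within {0..t})"
      by (simp add: has_real_derivative_iff_has_vector_derivative)
    \<comment> \<open>The metric entries agree with \<open>D\<close>, \<open>B\<close>,
      \<open>C\<close> only before the final time, so the derivative is transferred within
      \<open>{0..t}\<close>.\<close>
    then show ?thesis
      by (rule has_field_derivative_transform_within[OF _ zero_less_one s])
        (simp add: diagonal[OF I SU2_I])
  qed
  show "0 \<le> t" "D 0 \<le> C 0" "C 0 \<le> B 0" by fact+
  fix s assume s: "s \<in> {0..t}"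
  interpret left_invariant_diagonal "g s" "D s" "B s" "C s" using s by (rule inv)
  show "0 < D s" "0 < B s" "0 < C s" by (rule pos)+
  show "(D has_real_derivative - (4 / (B s * C s) * ((D s)\<^sup>2 - (B s - C s)\<^sup>2))) (at s within {0..t})"
    using comp[OF s, of 1] unfolding diag3_nth
    by (simp, elim DERIV_cong) (simp add: ricci_eq[OF SU2_I] divide_simps)
  show "(B has_real_derivative - (4 / (D s * C s) * ((B s)\<^sup>2 - (D s - C s)\<^sup>2))) (at s within {0..t})"
    using comp[OF s, of 2] unfolding diag3_nth
    by (simp, elim DERIV_cong) (simp add: ricci_eq[OF SU2_I] divide_simps)
  show "(C has_real_derivative - (4 / (D s * B s) * ((C s)\<^sup>2 - (D s - B s)\<^sup>2))) (at s within {0..t})"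
    using comp[OF s, of 3] unfolding diag3_nth
    by (simp, elim DERIV_cong) (simp add: ricci_eq[OF SU2_I] divide_simps)
qed

theorem theorem6p3:
  fixes \<epsilon> A0 B0 C0 \<delta> t :: real
    and g :: "real \<Rightarrow> su2_tensor"
    and D B C :: "real \<Rightarrow> real"
    and Tmax :: ereal
    and \<Omega> :: "mat2 set"
    and E :: "real \<Rightarrow> mat2 \<Rightarrow> real"
  assumes pos: "\<epsilon> > 0" "A0 > 0" "B0 > 0" "C0 > 0"
    and flow: "maximal_ricci_flow g Tmax"
    and init: "\<And>p. p \<in> SU2 \<Longrightarrow> g 0 p = diag3 (\<epsilon> * A0) B0 C0"
    and diagonal: "\<And>s p. 0 \<le> s \<Longrightarrow> ereal s < Tmax \<Longrightarrow> p \<in> SU2 \<Longrightarrow>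
                     g s p = diag3 (D s) (B s) (C s)"
    and dom: "precompact_smooth_domain \<Omega>"
    and torsion: "\<And>s. 0 \<le> s \<Longrightarrow> ereal s < Tmax \<Longrightarrow> torsion_function (g s) \<Omega> (E s)"
    and order: "\<epsilon> * A0 \<le> C0" "C0 \<le> B0"
    and delta: "\<delta> = (B0 - \<epsilon> * A0) / (\<epsilon> * A0)" "\<delta> < 1"
    and time: "0 \<le> t" "ereal t < min (ereal (B0 / (4 * (1 + 6 * \<delta>)))) Tmax"
  shows "(1 - 4 * (1 + 6 * \<delta>) * t / B0) powr (5 * (1 + \<delta>) ^ 3 / (2 * (1 + 6 * \<delta>)))
           * torsional_rigidity (g 0) \<Omega> (E 0)
         \<le> torsional_rigidity (g t) \<Omega> (E t)
       \<and> torsional_rigidity (g t) \<Omega> (E t)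
         \<le> (1 - 4 * t / B0) powr (5 * (1 - \<delta>) / (2 * (1 + \<delta>)))
           * torsional_rigidity (g 0) \<Omega> (E 0)"
proof -
  have flow': "ricci_flow g Tmax" using flow by (simp add: maximal_ricci_flow_def)
  have T: "ereal 0 < Tmax" "ereal t < Tmax"
    using flow' time by (auto simp: ricci_flow_def zero_ereal_def)
  have \<Omega>: "openin (top_of_set SU2) \<Omega>" using dom by (simp add: precompact_smooth_domain_def)
  have "diag3 (D 0) (B 0) (C 0) = diag3 (\<epsilon> * A0) B0 C0"
    using init[OF SU2_I] diagonal[OF _ T(1) SU2_I] by simp
  then have at0: "D 0 = \<epsilon> * A0" "B 0 = B0" "C 0 = C0" by (simp_all add: diag3_eq_iff)
  have A: "0 < \<epsilon> * A0" using pos by simp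
  have ode: "milnor_ricci_ode D B C t"
    using flow' time(1) T(2) diagonal by (rule ricci_flow_milnor_ode) (use at0 order in auto)
  have "\<delta> * (\<epsilon> * A0) = B0 - \<epsilon> * A0" unfolding delta(1) using less_imp_neq[OF A, symmetric] by (rule nonzero_eq_divide_eq[THEN iffD1, OF _ refl])
  then have "B0 = (1 + \<delta>) * (\<epsilon> * A0)" by (simp add: distrib_right)
  then interpret pinched_milnor_ricci_ode D B C t \<delta>
    using ode delta(2) by (simp add: pinched_milnor_ricci_ode_def pinched_milnor_ricci_ode_axioms_def at0)
  have "t < B0 / (4 * (1 + 6 * \<delta>))" using time(2) by simp
  then have time': "4 * (1 + 6 * \<delta>) * t < B 0"
    using delta_nonneg at0 by (simp add: field_simps)
  have "4 * t \<le> 4 * (1 + 6 * \<delta>) * t" using delta_nonneg time(1) by (simp add: algebra_simps)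
  with time' have base: "0 < 1 - 4 * t / B0" "0 < 1 - 4 * (1 + 6 * \<delta>) * t / B0"
    using assms(3) by (simp_all add: at0 field_simps)
  let ?R = "(1 - 4 * t / B0) powr ((1 - \<delta>) / (1 + \<delta>))"
  let ?S = "(1 - 4 * (1 + 6 * \<delta>) * t / B0) powr ((1 + \<delta>) ^ 3 / (1 + 6 * \<delta>))"
  have RS: "0 < ?R" "0 < ?S" using base by (metis less_irrefl powr_gt_zero)+
  have inv: "left_invariant_diagonal (g s) (D s) (B s) (C s)" if "s \<in> {0, t}" for s
  proof -
    have s: "0 \<le> s" "ereal s < Tmax" using that T time by auto
    show ?thesis using flow' s diagonal[OF s] by (rule ricci_flow_left_invariant_diagonal)
  qed
  have tors: "torsion_function (g s) \<Omega> (E s)" if "s \<in> {0, t}" for s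
    using that T time torsion by auto
  have up: "X t \<le> ?R * X 0" and low: "?S * X 0 \<le> X t" if "X \<in> {D, B, C}" for X
    using ratio_bounds[OF time' that] at0 by simp_all
  \<comment> \<open>Upper bound: the coefficients at time \<open>t\<close> are at most
    \<open>?R\<close> times the initial ones.\<close>
  have "torsional_rigidity (g t) \<Omega> (E t) \<le> ?R powr (5 / 2) * torsional_rigidity (g 0) \<Omega> (E 0)"
    using inv tors RS up by (intro torsional_rigidity_le[OF \<Omega>, of _ "D 0" "B 0" "C 0" _ "D t" "B t" "C t"]) auto
  moreover have "?R powr (5 / 2) = (1 - 4 * t / B0) powr (5 * (1 - \<delta>) / (2 * (1 + \<delta>)))"
    by (simp add: powr_powr mult.commute)
  \<comment> \<open>Lower bound: the same comparison with the two times exchanged, since the initial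
    coefficients are at most \<open>1 / ?S\<close> times those at time \<open>t\<close>.\<close>
  moreover have "torsional_rigidity (g 0) \<Omega> (E 0) \<le> (1 / ?S) powr (5 / 2) * torsional_rigidity (g t) \<Omega> (E t)"
    using inv tors RS low
    by (intro torsional_rigidity_le[OF \<Omega>, of _ "D t" "B t" "C t" _ "D 0" "B 0" "C 0"])
      (auto simp: pos_le_divide_eq mult.commute)
  then have "?S powr (5 / 2) * torsional_rigidity (g 0) \<Omega> (E 0) \<le> torsional_rigidity (g t) \<Omega> (E t)"
    using RS by (simp add: powr_divide pos_le_divide_eq mult.commute)
  moreover have "?S powr (5 / 2) = (1 - 4 * (1 + 6 * \<delta>) * t / B0) powr (5 * (1 + \<delta>) ^ 3 / (2 * (1 + 6 * \<delta>)))"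
    by (simp add: powr_powr mult.commute)
  ultimately show ?thesis by simp
qed

end
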